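(* Let $\mu$ and $\nu$ be valuated matroids on $[n]$ of ranks $r\le s$. Then $\mu\twoheadleftarrow\nu$ if and only if $\overline{\operatorname{trop}}(\mu)\subseteq\overline{\operatorname{trop}}(\nu)$. Consequently, a sequence $(\mu_1,\dots,\mu_k)$ of valuated matroids on $[n]$ is a valuated flag matroid if and only if $\overline{\operatorname{trop}}(\mu_1)\subseteq\cdots\subseteq\overline{\operatorname{trop}}(\mu_k)$.
   Context: $\mathbb T=\mathbb R\cup\{\infty\}$. $\mathbb P(\mathbb T^{E})$ is $\mathbb T^E$ minus the all-$\infty$ vector modulo $u\sim u+c\mathbf 1$ ($c\in\mathbb R$); for nonempty $S\subseteq E$, $T_S$ denotes the classes with finite coordinates exactly at $S$, identified with $\mathbb R^S/\mathbb R\mathbf 1$. A valuated matroid of rank $r$ on a finite set $E$ is $\mu:\binom{E}{r}\to\mathbb T$ such that $\mathcal B(M)=\{I:\mu(I)\ne\infty\}$ is the set of bases of a matroid $M$ (underlying matroid) and for all $B,B'\in\mathcal B(M)$, $i\in B\setminus B'$ there is $j\in B'\setminus B$ with $\mu(B)+\mu(B')\ge\mu(B\setminus i\cup j)+\mu(B'\setminus j\cup i)$. For $S\subseteq E$ let $\mathcal B_S$ be the bases $B$ with $|B\cap S|$ maximal; the contraction $\mu/_S$ (on ground set $E\setminus S$, finite exactly on bases of $M/_S$) and restriction $\mu|_S$ (finite exactly on bases of $M|_S$) are the valuated matroids, unique up to additive constants, with $\mu(B)=\mu|_S(B\cap S)+\mu/_S(B\setminus S)$ for $B\in\mathcal B_S$.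 Valuated circuits: $\mathbf C_\mu(S)$, $S\in\binom{E}{r+1}$, with coordinates $\mu(S\setminus i)$ for $i\in S$ and $\infty$ otherwise, excluding all-$\infty$. $\operatorname{trop}(\mu)\subseteq\mathbb R^E/\mathbb R\mathbf 1$ is the set of $\bar u$ such that for each valuated circuit $\mathbf C$ the minimum of $\{C_i+u_i:C_i\ne\infty\}$ is attained at least twice. The projective tropical linear space is $\overline{\operatorname{trop}}(\mu)=\bigcup_{\emptyset\subseteq S\subsetneq[n]}\operatorname{trop}(\mu/_S)\times\{\infty\}^S\subseteq\mathbb P(\mathbb T^{[n]})$, with $\operatorname{trop}(\mu/_S)$ viewed in $T_{[n]\setminus S}$. For valuated matroids $\mu,\nu$ on $[n]$ of ranks $r\le s$ with underlying matroids $M,N$, $\mu\twoheadleftarrow\nu$ (valuated quotient) means: for all $I\in\mathcal B(M)$, $J\in\mathcal B(N)$, $i\in I\setminus J$ there is $j\in J\setminus I$ with $\mu(I)+\nu(J)\ge\mu(I\setminus i\cup j)+\nu(J\setminus j\cup i)$. A valuated flag matroid is a sequence $(\mu_1,\dots,\mu_k)$ with nondecreasing ranks and $\mu_i\twoheadleftarrow\mu_j$ for all $i<j$. *)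

theory Defs
  imports "HOL-Library.Extended_Real" "HOL-Library.FuncSet"
begin

text \<open>
  The tropical numbers \<open>\<real> \<union> {\<infinity>}\<close> are the extended reals different from \<open>-\<infinity>\<close>.
  A function on the \<open>r\<close>-subsets of \<open>E\<close> is a function on all sets whose other values are ignored.
\<close>

definition matroid_bases :: "'a set \<Rightarrow> 'a set set \<Rightarrow> bool" where
  "matroid_bases E \<B> \<longleftrightarrow> finite E \<and> \<B> \<noteq> {} \<and> \<B> \<subseteq> Pow E \<and>
     (\<forall>B\<in>\<B>. \<forall>B'\<in>\<B>. \<forall>i\<in>B - B'. \<exists>j\<in>B' - B. insert j (B - {i}) \<in> \<B>)"

definition bases :: "'a set \<Rightarrow> nat \<Rightarrow> ('a set \<Rightarrow> ereal) \<Rightarrow> 'a set set" where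
  "bases E r \<mu> = {I. I \<subseteq> E \<and> card I = r \<and> \<mu> I \<noteq> \<infinity>}"

definition valuated_matroid :: "'a set \<Rightarrow> nat \<Rightarrow> ('a set \<Rightarrow> ereal) \<Rightarrow> bool" where
  "valuated_matroid E r \<mu> \<longleftrightarrow>
     (\<forall>I. I \<subseteq> E \<and> card I = r \<longrightarrow> \<mu> I \<noteq> -\<infinity>) \<and>
     matroid_bases E (bases E r \<mu>) \<and>
     (\<forall>B\<in>bases E r \<mu>. \<forall>B'\<in>bases E r \<mu>. \<forall>i\<in>B - B'. \<exists>j\<in>B' - B.
        \<mu> B + \<mu> B' \<ge> \<mu> (insert j (B - {i})) + \<mu> (insert i (B' - {j})))"

definition max_bases :: "'a set \<Rightarrow> nat \<Rightarrow> ('a set \<Rightarrow> ereal) \<Rightarrow> 'a set \<Rightarrow> 'a set set" where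
  "max_bases E r \<mu> S =
     {B \<in> bases E r \<mu>. \<forall>B'\<in>bases E r \<mu>. card (B' \<inter> S) \<le> card (B \<inter> S)}"

definition matroid_rank :: "'a set \<Rightarrow> nat \<Rightarrow> ('a set \<Rightarrow> ereal) \<Rightarrow> 'a set \<Rightarrow> nat" where
  "matroid_rank E r \<mu> S = Max ((\<lambda>B. card (B \<inter> S)) ` bases E r \<mu>)"

text \<open>
  \<open>\<rho>\<close> is a restriction of \<open>\<mu>\<close> to \<open>S\<close> and \<open>\<kappa>\<close> a matching contraction of \<open>\<mu>\<close> by \<open>S\<close>; the bases
  of \<open>M|S\<close> and of \<open>M/S\<close> are the sets \<open>B \<inter> S\<close> and \<open>B - S\<close> for \<open>B \<in> max_bases E r \<mu> S\<close>.
\<close>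

definition is_restriction_contraction ::
    "'a set \<Rightarrow> nat \<Rightarrow> ('a set \<Rightarrow> ereal) \<Rightarrow> 'a set \<Rightarrow> ('a set \<Rightarrow> ereal) \<Rightarrow> ('a set \<Rightarrow> ereal) \<Rightarrow> bool"
  where
  "is_restriction_contraction E r \<mu> S \<rho> \<kappa> \<longleftrightarrow>
     (let q = matroid_rank E r \<mu> S in
        valuated_matroid S q \<rho> \<and>
        valuated_matroid (E - S) (r - q) \<kappa> \<and>
        bases S q \<rho> = (\<lambda>B. B \<inter> S) ` max_bases E r \<mu> S \<and>
        bases (E - S) (r - q) \<kappa> = (\<lambda>B. B - S) ` max_bases E r \<mu> S \<and>
        (\<forall>B\<in>max_bases E r \<mu> S. \<mu> B = \<rho> (B \<inter> S) + \<kappa> (B - S)))"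

text \<open>
  Contractions are only determined up to additive constants (\<open>contraction_exists\<close>,
  \<open>contraction_unique\<close> below), which do not affect tropical linear spaces; one is chosen.
\<close>

definition contraction ::
    "'a set \<Rightarrow> nat \<Rightarrow> ('a set \<Rightarrow> ereal) \<Rightarrow> 'a set \<Rightarrow> 'a set \<Rightarrow> ereal" where
  "contraction E r \<mu> S = (SOME \<kappa>. \<exists>\<rho>. is_restriction_contraction E r \<mu> S \<rho> \<kappa>)"

definition circuit_vector :: "'a set \<Rightarrow> ('a set \<Rightarrow> ereal) \<Rightarrow> 'a set \<Rightarrow> 'a \<Rightarrow> ereal" where
  "circuit_vector E \<mu> S = (\<lambda>i\<in>E. if i \<in> S then \<mu> (S - {i}) else \<infinity>)"

definition valuated_circuits :: "'a set \<Rightarrow> nat \<Rightarrow> ('a set \<Rightarrow> ereal) \<Rightarrow> ('a \<Rightarrow> ereal) set" where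
  "valuated_circuits E r \<mu> =
     circuit_vector E \<mu> ` {S. S \<subseteq> E \<and> card S = r + 1} - {\<lambda>i\<in>E. \<infinity>}"

definition min_attained_twice :: "'a set \<Rightarrow> ('a \<Rightarrow> ereal) \<Rightarrow> ('a \<Rightarrow> real) \<Rightarrow> bool" where
  "min_attained_twice E C u \<longleftrightarrow>
     (\<exists>i j. i \<noteq> j \<and>
        is_arg_min (\<lambda>k. C k + ereal (u k)) (\<lambda>k. k \<in> E \<and> C k \<noteq> \<infinity>) i \<and>
        is_arg_min (\<lambda>k. C k + ereal (u k)) (\<lambda>k. k \<in> E \<and> C k \<noteq> \<infinity>) j)"

definition real_torus :: "'a set \<Rightarrow> ('a \<Rightarrow> real) set set" where
  "real_torus E =
     (E \<rightarrow>\<^sub>E UNIV) // {(u, v). u \<in> E \<rightarrow>\<^sub>E UNIV \<and> (\<exists>c. v = (\<lambda>i\<in>E. u i + c))}"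

definition tropical_projective_space :: "'a set \<Rightarrow> ('a \<Rightarrow> ereal) set set" where
  "tropical_projective_space E =
     (let V = (E \<rightarrow>\<^sub>E {x. x \<noteq> -\<infinity>}) - {\<lambda>i\<in>E. \<infinity>}
      in V // {(u, v). u \<in> V \<and> (\<exists>c::real. v = (\<lambda>i\<in>E. u i + ereal c))})"

definition trop :: "'a set \<Rightarrow> nat \<Rightarrow> ('a set \<Rightarrow> ereal) \<Rightarrow> ('a \<Rightarrow> real) set set" where
  "trop E r \<mu> =
     {U \<in> real_torus E. \<forall>u\<in>U. \<forall>C\<in>valuated_circuits E r \<mu>. min_attained_twice E C u}"

text \<open>
  The identification of the torus on \<open>E - S\<close> with the stratum of the tropical projective space
  of \<open>E\<close> whose finite coordinates are exactly those in \<open>E - S\<close>.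
\<close>

definition stratum_embedding :: "'a set \<Rightarrow> 'a set \<Rightarrow> ('a \<Rightarrow> real) set \<Rightarrow> ('a \<Rightarrow> ereal) set" where
  "stratum_embedding E S U = (\<lambda>u. \<lambda>i\<in>E. if i \<in> S then \<infinity> else ereal (u i)) ` U"

definition projective_trop :: "'a set \<Rightarrow> nat \<Rightarrow> ('a set \<Rightarrow> ereal) \<Rightarrow> ('a \<Rightarrow> ereal) set set" where
  "projective_trop E r \<mu> =
     (\<Union>S\<in>{S. S \<subset> E}. stratum_embedding E S `
        trop (E - S) (r - matroid_rank E r \<mu> S) (contraction E r \<mu> S))"

definition valuated_quotient ::
    "'a set \<Rightarrow> nat \<Rightarrow> ('a set \<Rightarrow> ereal) \<Rightarrow> nat \<Rightarrow> ('a set \<Rightarrow> ereal) \<Rightarrow> bool" where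
  "valuated_quotient E r \<mu> s \<nu> \<longleftrightarrow>
     (\<forall>I\<in>bases E r \<mu>. \<forall>J\<in>bases E s \<nu>. \<forall>i\<in>I - J. \<exists>j\<in>J - I.
        \<mu> I + \<nu> J \<ge> \<mu> (insert j (I - {i})) + \<nu> (insert i (J - {j})))"

definition valuated_flag_matroid ::
    "'a set \<Rightarrow> nat \<Rightarrow> (nat \<Rightarrow> nat) \<Rightarrow> (nat \<Rightarrow> 'a set \<Rightarrow> ereal) \<Rightarrow> bool" where
  "valuated_flag_matroid E k r \<mu> \<longleftrightarrow>
     (\<forall>i\<in>{1..k}. valuated_matroid E (r i) (\<mu> i)) \<and>
     (\<forall>i\<in>{1..k}. \<forall>j\<in>{1..k}. i < j \<longrightarrow>
        r i \<le> r j \<and> valuated_quotient E (r i) (\<mu> i) (r j) (\<mu> j))"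

lemma projective_trop_subset:
  "projective_trop E r \<mu> \<subseteq> tropical_projective_space E"
proof
  fix X assume "X \<in> projective_trop E r \<mu>"
  then obtain S U where S: "S \<subset> E" and U: "U \<in> real_torus (E - S)"
    and X: "X = stratum_embedding E S U"
    unfolding projective_trop_def trop_def by blast
  from U obtain u where u: "U = {\<lambda>i\<in>E - S. u i + c | c. True}"
    and uE: "u \<in> (E - S) \<rightarrow>\<^sub>E UNIV"
    unfolding real_torus_def quotient_def by blast
  define w where "w = (\<lambda>i\<in>E. if i \<in> S then \<infinity> else ereal (u i))"
  obtain e where e: "e \<in> E" "e \<notin> S" using S by blast
  have "w e \<noteq> (\<lambda>i\<in>E. \<infinity>) e" using e by (simp add: w_def)
  then have ne: "w \<noteq> (\<lambda>i\<in>E. \<infinity>)" by metis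
  have wV: "w \<in> (E \<rightarrow>\<^sub>E {x. x \<noteq> -\<infinity>}) - {\<lambda>i\<in>E. \<infinity>}"
    using ne by (auto simp: w_def)
  have eq: "(\<lambda>i\<in>E. if i \<in> S then \<infinity> else ereal ((\<lambda>i\<in>E - S. u i + c) i)) = (\<lambda>i\<in>E. w i + ereal c)"
    for c by (auto simp: w_def fun_eq_iff)
  have "X = {\<lambda>i\<in>E. w i + ereal c | c. True}"
    unfolding X stratum_embedding_def u using eq by (auto simp: image_iff) metis+
  then show "X \<in> tropical_projective_space E"
    unfolding tropical_projective_space_def Let_def quotient_def using wV by blast
qed

lemma max_bases_exchange:
  assumes vm: "valuated_matroid E r \<mu>" and S: "S \<subseteq> E"
    and B: "B \<in> max_bases E r \<mu> S" and B': "B' \<in> max_bases E r \<mu> S"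
    and i: "i \<in> B - B'"
  obtains j where "j \<in> B' - B" "j \<in> S \<longleftrightarrow> i \<in> S"
    "insert j (B - {i}) \<in> max_bases E r \<mu> S" "insert i (B' - {j}) \<in> max_bases E r \<mu> S"
    "\<mu> B + \<mu> B' \<ge> \<mu> (insert j (B - {i})) + \<mu> (insert i (B' - {j}))"
proof -
  have fE: "finite E" using vm unfolding valuated_matroid_def matroid_bases_def by blast
  have bB: "B \<in> bases E r \<mu>" "B' \<in> bases E r \<mu>" using B B' by (auto simp: max_bases_def)
  then obtain j where j: "j \<in> B' - B"
    and le: "\<mu> B + \<mu> B' \<ge> \<mu> (insert j (B - {i})) + \<mu> (insert i (B' - {j}))"
    using vm i unfolding valuated_matroid_def by blast
  have fB: "finite B" "finite B'" using bB fE by (auto simp: bases_def intro: finite_subset)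
  define B1 B2 where "B1 = insert j (B - {i})" and "B2 = insert i (B' - {j})"
  have sub: "B1 \<subseteq> E" "B2 \<subseteq> E" using bB i j by (auto simp: B1_def B2_def bases_def)
  have c1: "card B1 = Suc (card B - 1)" "card B2 = Suc (card B' - 1)"
    using i j fB by (simp_all add: B1_def B2_def)
  have "card B > 0" "card B' > 0" using i j fB by (auto simp: card_gt_0_iff)
  with c1 have crd: "card B1 = r" "card B2 = r" using bB by (auto simp: bases_def)
  have nm: "\<mu> B1 \<noteq> -\<infinity>" "\<mu> B2 \<noteq> -\<infinity>"
    using vm sub crd unfolding valuated_matroid_def by blast+
  have "\<mu> B \<noteq> \<infinity>" "\<mu> B' \<noteq> \<infinity>" using bB by (auto simp: bases_def)
  then have "\<mu> B + \<mu> B' \<noteq> \<infinity>" by simp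
  then have "\<mu> B1 + \<mu> B2 \<noteq> \<infinity>" using le by (auto simp: B1_def B2_def)
  then have bb: "B1 \<in> bases E r \<mu>" "B2 \<in> bases E r \<mu>"
    using sub crd nm by (auto simp: bases_def)
  have eqc: "card (B \<inter> S) = card (B' \<inter> S)"
    using B B' bB by (auto simp: max_bases_def intro: antisym)
  have l1: "card (B1 \<inter> S) \<le> card (B \<inter> S)" "card (B2 \<inter> S) \<le> card (B \<inter> S)"
    using B bb by (auto simp: max_bases_def)
  have k1: "card (B1 \<inter> S) + (if i \<in> S then 1 else 0) = card (B \<inter> S) + (if j \<in> S then 1 else 0)"
  proof -
    have "B1 \<inter> S = (if j \<in> S then insert j ((B \<inter> S) - {i}) else (B \<inter> S) - {i})"
      by (auto simp: B1_def)
    moreover have "card ((B \<inter> S) - {i}) + (if i \<in> S then 1 else 0) = card (B \<inter> S)"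
    proof (cases "i \<in> S")
      case True
      then have "i \<in> B \<inter> S" using i by blast
      then show ?thesis using True fB card_Suc_Diff1[of "B \<inter> S" i] by simp
    qed simp
    moreover have "j \<notin> (B \<inter> S) - {i}" using j by blast
    ultimately show ?thesis using fB by (auto split: if_splits)
  qed
  have k2: "card (B2 \<inter> S) + (if j \<in> S then 1 else 0) = card (B' \<inter> S) + (if i \<in> S then 1 else 0)"
  proof -
    have "B2 \<inter> S = (if i \<in> S then insert i ((B' \<inter> S) - {j}) else (B' \<inter> S) - {j})"
      by (auto simp: B2_def)
    moreover have "card ((B' \<inter> S) - {j}) + (if j \<in> S then 1 else 0) = card (B' \<inter> S)"
    proof (cases "j \<in> S")
      case True
      then have "j \<in> B' \<inter> S" using j by blast
      then show ?thesis using True fB card_Suc_Diff1[of "B' \<inter> S" j] by simp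
    qed simp
    moreover have "i \<notin> (B' \<inter> S) - {j}" using i by blast
    ultimately show ?thesis using fB by (auto split: if_splits)
  qed
  have ij: "j \<in> S \<longleftrightarrow> i \<in> S" using k1 k2 l1 eqc by (auto split: if_splits)
  then have "card (B1 \<inter> S) = card (B \<inter> S)" "card (B2 \<inter> S) = card (B \<inter> S)"
    using k1 k2 eqc by auto
  then have "B1 \<in> max_bases E r \<mu> S" "B2 \<in> max_bases E r \<mu> S"
    using bb B by (auto simp: max_bases_def)
  with that j ij le show ?thesis by (auto simp: B1_def B2_def)
qed

lemma max_bases_finite_value:
  assumes "valuated_matroid E r \<mu>" "B \<in> max_bases E r \<mu> S"
  shows "\<bar>\<mu> B\<bar> \<noteq> \<infinity>"
  using assms unfolding valuated_matroid_def max_bases_def bases_def by auto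

lemma max_bases_product_aux:
  assumes vm: "valuated_matroid E r \<mu>" and S: "S \<subseteq> E"
    and sub: "A \<subseteq> S" "A' \<subseteq> S" "J \<inter> S = {}" "J' \<inter> S = {}"
    and B: "A \<union> J \<in> max_bases E r \<mu> S" and B': "A' \<union> J' \<in> max_bases E r \<mu> S"
  shows "A' \<union> J \<in> max_bases E r \<mu> S"
  using sub B
proof (induction "card (A - A')" arbitrary: A)
  case 0
  have fE: "finite E" using vm unfolding valuated_matroid_def matroid_bases_def by blast
  then have fS: "finite S" using S finite_subset by blast
  have "A \<subseteq> A'" using 0 fS by (metis Diff_eq_empty_iff card_0_eq finite_Diff finite_subset)
  moreover have "card A = card A'"
  proof -
    have "card ((A \<union> J) \<inter> S) = card ((A' \<union> J') \<inter> S)"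
      using 0 B' by (auto simp: max_bases_def intro: antisym)
    moreover have "(A \<union> J) \<inter> S = A" "(A' \<union> J') \<inter> S = A'" using 0 sub by auto
    ultimately show ?thesis by simp
  qed
  ultimately have "A = A'" using fS sub by (metis card_subset_eq finite_subset)
  with 0 show ?case by simp
next
  case (Suc n)
  then obtain i where i: "i \<in> A - A'" by (metis card.empty ex_in_conv nat.distinct(1))
  have iS: "i \<in> S" "i \<in> (A \<union> J) - (A' \<union> J')" using i Suc.prems by auto
  obtain j where j: "j \<in> (A' \<union> J') - (A \<union> J)" "j \<in> S \<longleftrightarrow> i \<in> S"
    and m: "insert j ((A \<union> J) - {i}) \<in> max_bases E r \<mu> S"
    using max_bases_exchange[OF vm S Suc.prems(5) B' iS(2)] by metis
  have jA: "j \<in> A' - A" using j iS Suc.prems by auto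
  have eq: "insert j ((A \<union> J) - {i}) = insert j (A - {i}) \<union> J" using iS Suc.prems by auto
  have "insert j (A - {i}) - A' = (A - A') - {i}" using jA by auto
  moreover have "finite (A - A')" using Suc.hyps(2) card.infinite by force
  ultimately have "n = card (insert j (A - {i}) - A')" using Suc.hyps(2) i by simp
  moreover have "insert j (A - {i}) \<subseteq> S" using jA Suc.prems by auto
  ultimately show ?case using Suc.hyps(1)[of "insert j (A - {i})"] Suc.prems m eq by simp
qed

lemma max_bases_product:
  assumes vm: "valuated_matroid E r \<mu>" and S: "S \<subseteq> E"
    and B: "B \<in> max_bases E r \<mu> S" and B': "B' \<in> max_bases E r \<mu> S"
  shows "(B' \<inter> S) \<union> (B - S) \<in> max_bases E r \<mu> S"
  by (rule max_bases_product_aux[OF vm S, of "B \<inter> S" _ _ "B' - S"])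
     (use B B' in \<open>auto simp: Un_commute Int_Diff_Un Un_Diff_Int\<close>)

lemma max_bases_additive:
  assumes vm: "valuated_matroid E r \<mu>" and S: "S \<subseteq> E"
    and sub: "A \<subseteq> S" "A' \<subseteq> S" "J \<inter> S = {}" "J' \<inter> S = {}"
    and B: "A \<union> J \<in> max_bases E r \<mu> S" and B': "A' \<union> J' \<in> max_bases E r \<mu> S"
  shows "\<mu> (A \<union> J) + \<mu> (A' \<union> J') = \<mu> (A' \<union> J) + \<mu> (A \<union> J')"
  using sub B
proof (induction "card (A - A')" arbitrary: A)
  case 0
  have fE: "finite E" using vm unfolding valuated_matroid_def matroid_bases_def by blast
  then have fS: "finite S" using S finite_subset by blast
  have "A \<subseteq> A'" using 0 fS by (metis Diff_eq_empty_iff card_0_eq finite_Diff finite_subset)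
  moreover have "card A = card A'"
  proof -
    have "card ((A \<union> J) \<inter> S) = card ((A' \<union> J') \<inter> S)"
      using 0 B' by (auto simp: max_bases_def intro: antisym)
    moreover have "(A \<union> J) \<inter> S = A" "(A' \<union> J') \<inter> S = A'" using 0 sub by auto
    ultimately show ?thesis by simp
  qed
  ultimately have "A = A'" using fS sub by (metis card_subset_eq finite_subset)
  then show ?case by simp
next
  case (Suc n)
  note mb = max_bases_product_aux[OF vm S]
  then obtain i where i: "i \<in> A - A'"
    using Suc.hyps(2) by (metis card.empty ex_in_conv nat.distinct(1))
  have iS: "i \<in> S" "i \<in> (A \<union> J) - (A' \<union> J')" using i Suc.prems by auto
  obtain j where j: "j \<in> (A' \<union> J') - (A \<union> J)" "j \<in> S \<longleftrightarrow> i \<in> S"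
    and m: "insert j ((A \<union> J) - {i}) \<in> max_bases E r \<mu> S"
    using max_bases_exchange[OF vm S Suc.prems(5) B' iS(2)] by metis
  have jA: "j \<in> A' - A" using j iS Suc.prems by auto
  define A1 where "A1 = insert j (A - {i})"
  have A1S: "A1 \<subseteq> S" using jA Suc.prems by (auto simp: A1_def)
  have eq: "insert j ((A \<union> J) - {i}) = A1 \<union> J" using iS Suc.prems by (auto simp: A1_def)
  have m1: "A1 \<union> J \<in> max_bases E r \<mu> S" using m eq by simp
  have m1': "A1 \<union> J' \<in> max_bases E r \<mu> S" by (rule mb[OF sub(2) A1S sub(4,3) B' m1])
  have m0': "A \<union> J' \<in> max_bases E r \<mu> S"
    by (rule mb[OF sub(2) Suc.prems(1) sub(4,3) B' Suc.prems(5)])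
  have m2: "A' \<union> J \<in> max_bases E r \<mu> S"
    by (rule mb[OF Suc.prems(1) sub(2,3,4) Suc.prems(5) B'])
  have step: "\<mu> (A \<union> K) + \<mu> (A1 \<union> K') \<ge> \<mu> (A1 \<union> K) + \<mu> (A \<union> K')"
    if K: "K \<inter> S = {}" "K' \<inter> S = {}"
      and h: "A \<union> K \<in> max_bases E r \<mu> S" "A1 \<union> K' \<in> max_bases E r \<mu> S" for K K'
  proof -
    have "i \<in> (A \<union> K) - (A1 \<union> K')" using i jA K iS by (auto simp: A1_def)
    then obtain l where l: "l \<in> (A1 \<union> K') - (A \<union> K)" "l \<in> S \<longleftrightarrow> i \<in> S"
      and le: "\<mu> (A \<union> K) + \<mu> (A1 \<union> K')
                 \<ge> \<mu> (insert l ((A \<union> K) - {i})) + \<mu> (insert i ((A1 \<union> K') - {l}))"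
      using max_bases_exchange[OF vm S h] by metis
    have "l = j" using l iS K by (auto simp: A1_def)
    moreover have "insert j ((A \<union> K) - {i}) = A1 \<union> K" using iS K by (auto simp: A1_def)
    moreover have "insert i ((A1 \<union> K') - {j}) = A \<union> K'"
      using i jA K A1S by (auto simp: A1_def)
    ultimately show ?thesis using le by simp
  qed
  have e1: "\<mu> (A \<union> J) + \<mu> (A1 \<union> J') = \<mu> (A1 \<union> J) + \<mu> (A \<union> J')"
    using step[OF sub(3,4) Suc.prems(5) m1'] step[OF sub(4,3) m0' m1]
    by (simp add: add.commute antisym)
  have "A1 - A' = (A - A') - {i}" using jA by (auto simp: A1_def)
  moreover have "finite (A - A')" using Suc.hyps(2) card.infinite by force
  ultimately have "n = card (A1 - A')" using Suc.hyps(2) i by simp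
  then have e2: "\<mu> (A1 \<union> J) + \<mu> (A' \<union> J') = \<mu> (A' \<union> J) + \<mu> (A1 \<union> J')"
    using Suc.hyps(1) A1S Suc.prems m1 by auto
  have r: "\<exists>x. \<mu> X = ereal x" if "X \<in> max_bases E r \<mu> S" for X
    using max_bases_finite_value[OF vm that] by (cases "\<mu> X") auto
  obtain a b c d e f where "\<mu> (A \<union> J) = ereal a" "\<mu> (A' \<union> J') = ereal b"
      "\<mu> (A1 \<union> J) = ereal c" "\<mu> (A1 \<union> J') = ereal d"
      "\<mu> (A \<union> J') = ereal e" "\<mu> (A' \<union> J) = ereal f"
    using r[OF Suc.prems(5)] r[OF B'] r[OF m1] r[OF m1'] r[OF m0'] r[OF m2] by blast
  then show ?case using e1 e2 by simp
qed

lemma max_bases_nonempty: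
  assumes vm: "valuated_matroid E r \<mu>"
  shows "\<exists>B. B \<in> max_bases E r \<mu> S"
proof -
  have fE: "finite E" and ne: "bases E r \<mu> \<noteq> {}" and sub: "bases E r \<mu> \<subseteq> Pow E"
    using vm unfolding valuated_matroid_def matroid_bases_def by blast+
  have fin: "finite ((\<lambda>B. card (B \<inter> S)) ` bases E r \<mu>)"
    using fE sub by (meson finite_Pow_iff finite_imageI finite_subset)
  with ne have "Max ((\<lambda>B. card (B \<inter> S)) ` bases E r \<mu>) \<in> (\<lambda>B. card (B \<inter> S)) ` bases E r \<mu>"
    by (intro Max_in) auto
  then obtain B where B: "B \<in> bases E r \<mu>"
    "card (B \<inter> S) = Max ((\<lambda>B. card (B \<inter> S)) ` bases E r \<mu>)" by (elim imageE) simp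
  have "card (B' \<inter> S) \<le> card (B \<inter> S)" if "B' \<in> bases E r \<mu>" for B'
    unfolding B(2) using fin that by (intro Max_ge) auto
  with B(1) show ?thesis by (auto simp: max_bases_def)
qed

lemma matroid_rank_eq:
  assumes vm: "valuated_matroid E r \<mu>" and B: "B \<in> max_bases E r \<mu> S"
  shows "matroid_rank E r \<mu> S = card (B \<inter> S)"
proof -
  have "finite E" "bases E r \<mu> \<subseteq> Pow E"
    using vm unfolding valuated_matroid_def matroid_bases_def by blast+
  then have "finite ((\<lambda>B. card (B \<inter> S)) ` bases E r \<mu>)"
    by (meson finite_Pow_iff finite_imageI finite_subset)
  then show ?thesis
    unfolding matroid_rank_def using B by (intro Max_eqI) (auto simp: max_bases_def)
qed

lemma valuated_matroidI:
  assumes "finite E" and "\<And>I. I \<subseteq> E \<Longrightarrow> card I = r \<Longrightarrow> \<mu> I \<noteq> -\<infinity>" and "bases E r \<mu> \<noteq> {}"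
    and ex: "\<And>B B' i. B \<in> bases E r \<mu> \<Longrightarrow> B' \<in> bases E r \<mu> \<Longrightarrow> i \<in> B - B' \<Longrightarrow>
      \<exists>j\<in>B' - B. insert j (B - {i}) \<in> bases E r \<mu> \<and>
        \<mu> B + \<mu> B' \<ge> \<mu> (insert j (B - {i})) + \<mu> (insert i (B' - {j}))"
  shows "valuated_matroid E r \<mu>"
proof -
  have "bases E r \<mu> \<subseteq> Pow E" by (auto simp: bases_def)
  then have "matroid_bases E (bases E r \<mu>)"
    unfolding matroid_bases_def using assms(1,3) ex by blast
  then show ?thesis unfolding valuated_matroid_def using assms(2) ex by blast
qed

lemma contraction_exists:
  assumes vm: "valuated_matroid E r \<mu>" and S: "S \<subseteq> E"
  shows "\<exists>\<rho> \<kappa>. is_restriction_contraction E r \<mu> S \<rho> \<kappa>"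
proof -
  obtain B0 where B0: "B0 \<in> max_bases E r \<mu> S" using max_bases_nonempty[OF vm] by blast
  define A0 J0 q where "A0 = B0 \<inter> S" and "J0 = B0 - S" and "q = matroid_rank E r \<mu> S"
  have fE: "finite E" using vm unfolding valuated_matroid_def matroid_bases_def by blast
  have fS: "finite S" using fE S finite_subset by blast
  have B0E: "B0 \<subseteq> E" "card B0 = r" using B0 by (auto simp: max_bases_def bases_def)
  have fB0: "finite B0" using B0E fE finite_subset by blast
  have B0eq: "B0 = A0 \<union> J0" by (auto simp: A0_def J0_def)
  have A0: "A0 \<subseteq> S" "finite A0" and J0: "J0 \<inter> S = {}" "J0 \<subseteq> E" "finite J0"
    using fB0 B0E by (auto simp: A0_def J0_def)
  have q: "q = card A0" using matroid_rank_eq[OF vm B0] by (simp add: q_def A0_def)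
  have "card B0 = card A0 + card J0" unfolding B0eq using A0 J0 by (intro card_Un_disjoint) auto
  then have r: "r = q + card J0" using q B0E by simp
  have rank: "card (B \<inter> S) = q" if "B \<in> max_bases E r \<mu> S" for B
    using matroid_rank_eq[OF vm that] by (simp add: q_def)
  have max: "B \<in> max_bases E r \<mu> S" if "B \<subseteq> E" "card B = r" "\<mu> B \<noteq> \<infinity>" "card (B \<inter> S) = q" for B
    using that B0 q by (auto simp: max_bases_def bases_def A0_def)
  obtain m where m: "\<mu> B0 = ereal m"
    using max_bases_finite_value[OF vm B0] by (cases "\<mu> B0") auto
  define \<rho> \<kappa> where "\<rho> = (\<lambda>A. \<mu> (A \<union> J0))" and "\<kappa> = (\<lambda>J. \<mu> (A0 \<union> J) + ereal (- m))"
  have cA: "A \<union> J0 \<subseteq> E \<and> card (A \<union> J0) = r \<and> (A \<union> J0) \<inter> S = A" if "A \<subseteq> S" "card A = q" for A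
  proof -
    have "card (A \<union> J0) = card A + card J0"
      using that J0 fS by (intro card_Un_disjoint) (auto intro: finite_subset)
    then show ?thesis using that J0 S r by auto
  qed
  have cJ: "A0 \<union> J \<subseteq> E \<and> card (A0 \<union> J) = r \<and> (A0 \<union> J) \<inter> S = A0 \<and> (A0 \<union> J) - S = J"
    if "J \<subseteq> E - S" "card J = r - q" for J
  proof -
    have "card (A0 \<union> J) = card A0 + card J"
      using that A0 fE by (intro card_Un_disjoint) (auto intro: finite_subset)
    then show ?thesis using that A0 S r q by auto
  qed
  have b\<rho>: "A \<in> bases S q \<rho> \<longleftrightarrow> A \<subseteq> S \<and> A \<union> J0 \<in> max_bases E r \<mu> S" for A
  proof
    assume "A \<in> bases S q \<rho>"
    then have h: "A \<subseteq> S" "card A = q" "\<mu> (A \<union> J0) \<noteq> \<infinity>" by (auto simp: bases_def \<rho>_def)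
    then show "A \<subseteq> S \<and> A \<union> J0 \<in> max_bases E r \<mu> S" using max cA[OF h(1,2)] by auto
  next
    assume h: "A \<subseteq> S \<and> A \<union> J0 \<in> max_bases E r \<mu> S"
    moreover have "(A \<union> J0) \<inter> S = A" using h J0 by auto
    ultimately have "card A = q" using rank by metis
    then show "A \<in> bases S q \<rho>" using h by (auto simp: bases_def \<rho>_def max_bases_def)
  qed
  have b\<kappa>: "J \<in> bases (E - S) (r - q) \<kappa> \<longleftrightarrow> J \<inter> S = {} \<and> A0 \<union> J \<in> max_bases E r \<mu> S" for J
  proof
    assume "J \<in> bases (E - S) (r - q) \<kappa>"
    then have h: "J \<subseteq> E - S" "card J = r - q" "\<mu> (A0 \<union> J) \<noteq> \<infinity>"
      by (auto simp: bases_def \<kappa>_def)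
    then show "J \<inter> S = {} \<and> A0 \<union> J \<in> max_bases E r \<mu> S" using max cJ[OF h(1,2)] q by auto
  next
    assume h: "J \<inter> S = {} \<and> A0 \<union> J \<in> max_bases E r \<mu> S"
    then have JE: "A0 \<union> J \<subseteq> E" "card (A0 \<union> J) = r" "\<mu> (A0 \<union> J) \<noteq> \<infinity>"
      by (auto simp: max_bases_def bases_def)
    have "card (A0 \<union> J) = card A0 + card J"
      using A0 fE JE h by (intro card_Un_disjoint) (auto intro: finite_subset)
    then have "card J = r - q" using JE q by simp
    then show "J \<in> bases (E - S) (r - q) \<kappa>" using h JE by (auto simp: bases_def \<kappa>_def)
  qed
  have "bases S q \<rho> = (\<lambda>B. B \<inter> S) ` max_bases E r \<mu> S"
  proof (intro set_eqI iffI)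
    fix A assume "A \<in> bases S q \<rho>"
    then have "A \<subseteq> S" "A \<union> J0 \<in> max_bases E r \<mu> S" using b\<rho> by auto
    moreover from this have "A = (A \<union> J0) \<inter> S" using J0 by auto
    ultimately show "A \<in> (\<lambda>B. B \<inter> S) ` max_bases E r \<mu> S" by blast
  next
    fix A assume "A \<in> (\<lambda>B. B \<inter> S) ` max_bases E r \<mu> S"
    then obtain B where B: "B \<in> max_bases E r \<mu> S" "A = B \<inter> S" by blast
    show "A \<in> bases S q \<rho>"
      using max_bases_product[OF vm S B0 B(1)] B(2) b\<rho> by (auto simp: J0_def)
  qed
  moreover have "bases (E - S) (r - q) \<kappa> = (\<lambda>B. B - S) ` max_bases E r \<mu> S"
  proof (intro set_eqI iffI)
    fix J assume "J \<in> bases (E - S) (r - q) \<kappa>"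
    then have "J \<inter> S = {}" "A0 \<union> J \<in> max_bases E r \<mu> S" using b\<kappa> by auto
    moreover from this have "J = (A0 \<union> J) - S" using A0 by auto
    ultimately show "J \<in> (\<lambda>B. B - S) ` max_bases E r \<mu> S" by blast
  next
    fix J assume "J \<in> (\<lambda>B. B - S) ` max_bases E r \<mu> S"
    then obtain B where B: "B \<in> max_bases E r \<mu> S" "J = B - S" by blast
    show "J \<in> bases (E - S) (r - q) \<kappa>"
      using max_bases_product[OF vm S B(1) B0] B(2) b\<kappa> by (auto simp: A0_def)
  qed
  moreover have "\<mu> B = \<rho> (B \<inter> S) + \<kappa> (B - S)" if B: "B \<in> max_bases E r \<mu> S" for B
  proof -
    have Beq: "(B \<inter> S) \<union> (B - S) = B" by auto
    have "\<mu> ((B \<inter> S) \<union> (B - S)) + \<mu> (A0 \<union> J0) = \<mu> (A0 \<union> (B - S)) + \<mu> ((B \<inter> S) \<union> J0)"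
      by (rule max_bases_additive[OF vm S]) (use B B0 A0 J0 B0eq Beq in auto)
    then have eq: "\<mu> B + ereal m = \<mu> (A0 \<union> (B - S)) + \<mu> ((B \<inter> S) \<union> J0)"
      using Beq B0eq m by simp
    obtain b where "\<mu> B = ereal b"
      using max_bases_finite_value[OF vm B] by (cases "\<mu> B") auto
    with eq show ?thesis unfolding \<rho>_def \<kappa>_def
      by (cases "\<mu> (A0 \<union> (B - S))"; cases "\<mu> ((B \<inter> S) \<union> J0)") auto
  qed
  moreover have "valuated_matroid S q \<rho>"
  proof (rule valuated_matroidI)
    show "\<rho> I \<noteq> -\<infinity>" if "I \<subseteq> S" "card I = q" for I
      using vm cA[OF that] unfolding \<rho>_def valuated_matroid_def by blast
    show "bases S q \<rho> \<noteq> {}" using b\<rho>[of A0] B0 B0eq A0 by auto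
    fix A A' i assume h: "A \<in> bases S q \<rho>" "A' \<in> bases S q \<rho>" "i \<in> A - A'"
    then have AS: "A \<subseteq> S" "A' \<subseteq> S" "A \<union> J0 \<in> max_bases E r \<mu> S" "A' \<union> J0 \<in> max_bases E r \<mu> S"
      using b\<rho> by auto
    have i: "i \<in> (A \<union> J0) - (A' \<union> J0)" using h AS J0 by auto
    obtain j where j: "j \<in> (A' \<union> J0) - (A \<union> J0)"
      "insert j ((A \<union> J0) - {i}) \<in> max_bases E r \<mu> S"
      "\<mu> (A \<union> J0) + \<mu> (A' \<union> J0)
        \<ge> \<mu> (insert j ((A \<union> J0) - {i})) + \<mu> (insert i ((A' \<union> J0) - {j}))"
      by (rule max_bases_exchange[OF vm S AS(3,4) i])
    have e: "insert j ((A \<union> J0) - {i}) = insert j (A - {i}) \<union> J0"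
      "insert i ((A' \<union> J0) - {j}) = insert i (A' - {j}) \<union> J0" using i j by auto
    show "\<exists>j\<in>A' - A. insert j (A - {i}) \<in> bases S q \<rho> \<and>
        \<rho> A + \<rho> A' \<ge> \<rho> (insert j (A - {i})) + \<rho> (insert i (A' - {j}))"
    proof (intro bexI conjI)
      show "j \<in> A' - A" using j by auto
      then have "insert j (A - {i}) \<subseteq> S" using AS by auto
      then show "insert j (A - {i}) \<in> bases S q \<rho>" using b\<rho> j(2) e(1) by simp
      show "\<rho> A + \<rho> A' \<ge> \<rho> (insert j (A - {i})) + \<rho> (insert i (A' - {j}))"
        using j(3) unfolding \<rho>_def e .
    qed
  qed (rule fS)
  moreover have "valuated_matroid (E - S) (r - q) \<kappa>"
  proof (rule valuated_matroidI)
    show "\<kappa> I \<noteq> -\<infinity>" if "I \<subseteq> E - S" "card I = r - q" for I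
    proof -
      have "\<mu> (A0 \<union> I) \<noteq> -\<infinity>" using vm cJ[OF that] unfolding valuated_matroid_def by blast
      then show ?thesis by (simp add: \<kappa>_def)
    qed
    show "bases (E - S) (r - q) \<kappa> \<noteq> {}" using b\<kappa>[of J0] B0 B0eq J0 by auto
    fix J J' i assume h: "J \<in> bases (E - S) (r - q) \<kappa>" "J' \<in> bases (E - S) (r - q) \<kappa>" "i \<in> J - J'"
    then have JS: "J \<inter> S = {}" "J' \<inter> S = {}"
      "A0 \<union> J \<in> max_bases E r \<mu> S" "A0 \<union> J' \<in> max_bases E r \<mu> S"
      using b\<kappa> by auto
    have i: "i \<in> (A0 \<union> J) - (A0 \<union> J')" using h JS A0 by auto
    obtain j where j: "j \<in> (A0 \<union> J') - (A0 \<union> J)"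
      "insert j ((A0 \<union> J) - {i}) \<in> max_bases E r \<mu> S"
      "\<mu> (A0 \<union> J) + \<mu> (A0 \<union> J')
        \<ge> \<mu> (insert j ((A0 \<union> J) - {i})) + \<mu> (insert i ((A0 \<union> J') - {j}))"
      by (rule max_bases_exchange[OF vm S JS(3,4) i])
    have e: "insert j ((A0 \<union> J) - {i}) = A0 \<union> insert j (J - {i})"
      "insert i ((A0 \<union> J') - {j}) = A0 \<union> insert i (J' - {j})" using i j by auto
    show "\<exists>j\<in>J' - J. insert j (J - {i}) \<in> bases (E - S) (r - q) \<kappa> \<and>
        \<kappa> J + \<kappa> J' \<ge> \<kappa> (insert j (J - {i})) + \<kappa> (insert i (J' - {j}))"
    proof (intro bexI conjI)
      show "j \<in> J' - J" using j by auto
      then have "insert j (J - {i}) \<inter> S = {}" using JS by auto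
      then show "insert j (J - {i}) \<in> bases (E - S) (r - q) \<kappa>" using b\<kappa> j(2) e(1) by simp
      have "\<kappa> (insert j (J - {i})) + \<kappa> (insert i (J' - {j})) =
          \<mu> (A0 \<union> insert j (J - {i})) + \<mu> (A0 \<union> insert i (J' - {j})) + (ereal (- m) + ereal (- m))"
        unfolding \<kappa>_def by (simp only: ac_simps)
      also have "\<dots> \<le> \<mu> (A0 \<union> J) + \<mu> (A0 \<union> J') + (ereal (- m) + ereal (- m))"
        using j(3) unfolding e by (rule add_right_mono)
      also have "\<dots> = \<kappa> J + \<kappa> J'" unfolding \<kappa>_def by (simp only: ac_simps)
      finally show "\<kappa> J + \<kappa> J' \<ge> \<kappa> (insert j (J - {i})) + \<kappa> (insert i (J' - {j}))" .
    qed
  qed (use fE in simp)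
  ultimately have "is_restriction_contraction E r \<mu> S \<rho> \<kappa>"
    unfolding is_restriction_contraction_def Let_def q_def by blast
  then show ?thesis by blast
qed

lemma contraction_unique:
  assumes vm: "valuated_matroid E r \<mu>" and S: "S \<subseteq> E"
    and c1: "is_restriction_contraction E r \<mu> S \<rho> \<kappa>"
    and c2: "is_restriction_contraction E r \<mu> S \<rho>' \<kappa>'"
  shows "\<exists>c::real. \<forall>J. J \<subseteq> E - S \<and> card J = r - matroid_rank E r \<mu> S \<longrightarrow> \<kappa>' J = \<kappa> J + ereal c"
proof -
  obtain B0 where B0: "B0 \<in> max_bases E r \<mu> S" using max_bases_nonempty[OF vm] by blast
  define A0 q where "A0 = B0 \<inter> S" and "q = matroid_rank E r \<mu> S"
  have b: "bases (E - S) (r - q) \<kappa> = (\<lambda>B. B - S) ` max_bases E r \<mu> S"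
    "bases (E - S) (r - q) \<kappa>' = (\<lambda>B. B - S) ` max_bases E r \<mu> S"
    and v: "\<And>B. B \<in> max_bases E r \<mu> S \<Longrightarrow> \<mu> B = \<rho> (B \<inter> S) + \<kappa> (B - S)"
    "\<And>B. B \<in> max_bases E r \<mu> S \<Longrightarrow> \<mu> B = \<rho>' (B \<inter> S) + \<kappa>' (B - S)"
    using c1 c2 unfolding is_restriction_contraction_def Let_def q_def by simp_all
  have fin: "\<bar>\<mu> B0\<bar> \<noteq> \<infinity>" by (rule max_bases_finite_value[OF vm B0])
  have "\<rho> A0 + \<kappa> (B0 - S) = \<mu> B0" "\<rho>' A0 + \<kappa>' (B0 - S) = \<mu> B0"
    using v[OF B0] by (auto simp: A0_def)
  then obtain a a' where a: "\<rho> A0 = ereal a" "\<rho>' A0 = ereal a'"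
    using fin by (cases "\<rho> A0"; cases "\<rho>' A0"; cases "\<kappa> (B0 - S)"; cases "\<kappa>' (B0 - S)") auto
  have "\<kappa>' J = \<kappa> J + ereal (a - a')" if J: "J \<subseteq> E - S" "card J = r - q" for J
  proof (cases "J \<in> bases (E - S) (r - q) \<kappa>")
    case True
    then obtain B where B: "B \<in> max_bases E r \<mu> S" "J = B - S" using b by auto
    have m: "A0 \<union> J \<in> max_bases E r \<mu> S"
      using max_bases_product[OF vm S B(1) B0] B(2) by (simp add: A0_def)
    have "(A0 \<union> J) \<inter> S = A0" "(A0 \<union> J) - S = J" using J by (auto simp: A0_def)
    then have "\<mu> (A0 \<union> J) = ereal a + \<kappa> J" "\<mu> (A0 \<union> J) = ereal a' + \<kappa>' J"
      using v[OF m] a by simp_all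
    then show ?thesis
      by (cases "\<kappa> J"; cases "\<kappa>' J"; cases "\<mu> (A0 \<union> J)") auto
  next
    case False
    then have "J \<notin> bases (E - S) (r - q) \<kappa>'" using b by simp
    with False J have "\<kappa> J = \<infinity>" "\<kappa>' J = \<infinity>" by (auto simp: bases_def)
    then show ?thesis by simp
  qed
  then show ?thesis unfolding q_def by blast
qed

end

theory Submission imports Defs begin

text \<open>
  Both sides are compared through vectors \<open>w\<close> with values in \<open>\<real> \<union> {\<infinity>}\<close>. If \<open>w\<close> satisfies the
  circuit conditions of \<open>\<mu>\<close>, then a basis that first maximises its intersection with the infinite
  coordinates of \<open>w\<close> and then minimises \<open>\<mu>(B) - w(B)\<close> can be chosen through any given finite
  coordinate \<open>e\<close>; this exhibits \<open>w\<close> as a tropical combination of valuated cocircuits of \<open>\<mu>\<close>. The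
  exchange property of a quotient says precisely that the cocircuits of \<open>\<mu>\<close> satisfy the circuit
  conditions of \<open>\<nu>\<close>, so the quotient relation is the inclusion of solution sets. Passing through
  cocircuits also shows that the solutions with infinite coordinates \<open>S\<close> are those of the
  contraction by \<open>S\<close>. Finally, a quotient relation alone forces the ranks to be ordered.
\<close>

text \<open>
  A minimum is attained twice, or is infinite, iff every finite term is matched by another one
  that is at most as large.
\<close>

definition satisfies_circuits ::
    "'a set \<Rightarrow> nat \<Rightarrow> ('a set \<Rightarrow> ereal) \<Rightarrow> ('a \<Rightarrow> ereal) \<Rightarrow> bool" where
  "satisfies_circuits E r \<mu> w \<longleftrightarrow>
     (\<forall>T e. T \<subseteq> E \<longrightarrow> card T = r + 1 \<longrightarrow> e \<in> T \<longrightarrow> \<mu> (T - {e}) + w e \<noteq> \<infinity> \<longrightarrow>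
        (\<exists>j\<in>T - {e}. \<mu> (T - {j}) + w j \<le> \<mu> (T - {e}) + w e))"

text \<open>
  The cocircuit with coordinates \<open>\<mu> (insert i (B - {e}))\<close>, scaled by \<open>w e - \<mu> B\<close>, dominates \<open>w\<close>
  and agrees with it at \<open>e\<close>.
\<close>

definition spanned_by_cocircuits ::
    "'a set \<Rightarrow> nat \<Rightarrow> ('a set \<Rightarrow> ereal) \<Rightarrow> ('a \<Rightarrow> ereal) \<Rightarrow> bool" where
  "spanned_by_cocircuits E r \<mu> w \<longleftrightarrow>
     (\<forall>e\<in>E. w e \<noteq> \<infinity> \<longrightarrow>
        (\<exists>B\<in>bases E r \<mu>. e \<in> B \<and> (\<forall>i\<in>E - B. \<mu> B + w i \<le> \<mu> (insert i (B - {e})) + w e)))"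

text \<open>The representatives \<open>V\<close> from which \<open>tropical_projective_space\<close>
  is formed as a quotient.\<close>

abbreviation tropical_vectors :: "'a set \<Rightarrow> ('a \<Rightarrow> ereal) set" where
  "tropical_vectors E \<equiv> (E \<rightarrow>\<^sub>E {x. x \<noteq> -\<infinity>}) - {\<lambda>i\<in>E. \<infinity>}"

abbreviation projective_class :: "'a set \<Rightarrow> ('a \<Rightarrow> ereal) \<Rightarrow> ('a \<Rightarrow> ereal) set" where
  "projective_class E w \<equiv> range (\<lambda>c::real. \<lambda>i\<in>E. w i + ereal c)"

section \<open>Values, bases and single exchanges\<close>

lemma valuated_matroid_finite: "valuated_matroid E r \<mu> \<Longrightarrow> finite E"
  unfolding valuated_matroid_def matroid_bases_def by blast

lemma valuated_matroid_bases_nonempty: "valuated_matroid E r \<mu> \<Longrightarrow> bases E r \<mu> \<noteq> {}"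
  unfolding valuated_matroid_def matroid_bases_def by (elim conjE)

lemma valuated_matroid_not_MInfty:
  "valuated_matroid E r \<mu> \<Longrightarrow> I \<subseteq> E \<Longrightarrow> card I = r \<Longrightarrow> \<mu> I \<noteq> -\<infinity>"
  unfolding valuated_matroid_def by blast

lemma bases_value_real:
  assumes "valuated_matroid E r \<mu>" "B \<in> bases E r \<mu>"
  obtains b where "\<mu> B = ereal b"
  using assms valuated_matroid_not_MInfty[OF assms(1), of B]
  by (cases "\<mu> B") (auto simp: bases_def)

lemma valuated_matroid_self_quotient:
  "valuated_matroid E r \<mu> \<Longrightarrow> valuated_quotient E r \<mu> r \<mu>"
  unfolding valuated_matroid_def valuated_quotient_def by blast

lemma card_exchange: "finite A \<Longrightarrow> e \<in> A \<Longrightarrow> i \<notin> A \<Longrightarrow> card (insert i (A - {e})) = card A"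
  using card_Suc_Diff1[of A e] by simp

section \<open>Circuit conditions and cocircuit spans\<close>

text \<open>Take the cocircuit of \<mu> that dominates \<open>w\<close> and touches it at
  \<open>e\<close>, given by a basis \<open>B\<close>. Quotient exchange of \<open>e\<close> between
  \<open>B\<close> and \<open>T - {e}\<close> yields \<open>j\<close>. Adding the exchange
  inequality to domination at \<open>j\<close>, the terms \<open>\<mu> B\<close> and
  \<open>\<mu> (insert j (B - {e}))\<close> are finite and cancel, which leaves the circuit
  inequality for \<nu>.\<close>

lemma spanned_by_cocircuits_satisfies_circuits:
  assumes vm: "valuated_matroid E r \<mu>" and vn: "valuated_matroid E s \<nu>"
    and q: "valuated_quotient E r \<mu> s \<nu>"
    and w: "\<And>i. i \<in> E \<Longrightarrow> w i \<noteq> -\<infinity>" and sp: "spanned_by_cocircuits E r \<mu> w"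
  shows "satisfies_circuits E s \<nu> w"
  unfolding satisfies_circuits_def
proof (intro allI impI)
  fix T e assume T: "T \<subseteq> E" "card T = s + 1" "e \<in> T" and fin: "\<nu> (T - {e}) + w e \<noteq> \<infinity>"
  have fT: "finite T" using T(2) card.infinite by fastforce
  have ct: "card (T - {j}) = s" if "j \<in> T" for j using that T(2) fT by simp
  have J: "T - {e} \<in> bases E s \<nu>" using T fin ct by (auto simp: bases_def)
  obtain n where n: "\<nu> (T - {e}) = ereal n" using bases_value_real[OF vn J] .
  have eE: "e \<in> E" "w e \<noteq> \<infinity>" using T fin by auto
  then obtain x where x: "w e = ereal x" using w[of e] by (cases "w e") auto
  obtain B where B: "B \<in> bases E r \<mu>" "e \<in> B"
    and le: "\<forall>i\<in>E - B. \<mu> B + w i \<le> \<mu> (insert i (B - {e})) + w e"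
    using sp eE unfolding spanned_by_cocircuits_def by blast
  obtain b where b: "\<mu> B = ereal b" using bases_value_real[OF vm B(1)] .
  have BE: "B \<subseteq> E" "card B = r" using B by (auto simp: bases_def)
  have fB: "finite B" using BE valuated_matroid_finite[OF vm] finite_subset by blast
  obtain j where j: "j \<in> (T - {e}) - B"
    and ex: "\<mu> (insert j (B - {e})) + \<nu> (insert e ((T - {e}) - {j})) \<le> \<mu> B + \<nu> (T - {e})"
    using q B J unfolding valuated_quotient_def by blast
  have jE: "j \<in> E" using j T by auto
  have eq: "insert e ((T - {e}) - {j}) = T - {j}" using j T by auto
  have "\<mu> (insert j (B - {e})) \<noteq> -\<infinity>"
    by (rule valuated_matroid_not_MInfty[OF vm]) (use BE jE card_exchange[OF fB B(2)] j in auto)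
  moreover have "\<nu> (T - {j}) \<noteq> -\<infinity>"
    by (rule valuated_matroid_not_MInfty[OF vn]) (use T j ct in auto)
  moreover have "w j \<noteq> -\<infinity>" using w jE .
  moreover have "\<mu> B + w j \<le> \<mu> (insert j (B - {e})) + w e" using le jE j by blast
  ultimately have "\<nu> (T - {j}) + w j \<le> \<nu> (T - {e}) + w e"
    using ex unfolding eq n b x
    by (cases "\<mu> (insert j (B - {e}))"; cases "\<nu> (T - {j})"; cases "w j") auto
  then show "\<exists>j\<in>T - {e}. \<nu> (T - {j}) + w j \<le> \<nu> (T - {e}) + w e" using j by blast
qed

text \<open>The cocircuit is read off an optimal basis through \<open>e\<close>: domination at
  \<open>i\<close> is the statement that replacing \<open>e\<close> by \<open>i\<close> does not
  improve the basis. The circuit condition is what moves an optimal basis so that it contains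
  \<open>e\<close>.\<close>

lemma satisfies_circuits_spanned_by_cocircuits:
  assumes vm: "valuated_matroid E r \<mu>" and w: "\<And>i. i \<in> E \<Longrightarrow> w i \<noteq> -\<infinity>"
    and L: "satisfies_circuits E r \<mu> w"
  shows "spanned_by_cocircuits E r \<mu> w"
  unfolding spanned_by_cocircuits_def
proof (intro ballI impI)
  fix e assume e: "e \<in> E" "w e \<noteq> \<infinity>"
  have fE: "finite E" using valuated_matroid_finite[OF vm] .
  define Z where "Z = {i \<in> E. w i = \<infinity>}"
  \<comment> \<open>Infinite entries become 0 here, but \<open>v\<close> is only ever used off
    \<open>Z\<close>, where it is the true value of \<open>w\<close>.\<close>
  define v where "v i = real_of_ereal (w i)" for i
  have wv: "w i = ereal (v i)" if "i \<in> E" "i \<notin> Z" for i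
    using that w[of i] by (cases "w i") (auto simp: v_def Z_def)
  \<comment> \<open>On \<open>M\<close> the value \<open>\<mu> B\<close> is real, so the conversion
    loses nothing. Minimising \<open>f\<close> over \<open>M\<close> is the lexicographic choice:
    infinite weights are counted first, finite weights are compared second.\<close>
  define f where "f B = real_of_ereal (\<mu> B) - (\<Sum>i\<in>B - Z. v i)" for B
  define M where "M = max_bases E r \<mu> Z"
  have Mb: "B \<in> bases E r \<mu>" "B \<subseteq> E" "card B = r" "finite B" if "B \<in> M" for B
    using that fE by (auto simp: M_def max_bases_def bases_def intro: finite_subset)
  have "finite M" using Mb(2) fE by (meson PowI finite_Pow_iff finite_subset subsetI)
  moreover have "M \<noteq> {}" using max_bases_nonempty[OF vm] by (auto simp: M_def)
  ultimately obtain B0 where B0: "B0 \<in> M" "\<And>B. B \<in> M \<Longrightarrow> f B0 \<le> f B"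
    using arg_min_if_finite[of M f] by (metis linorder_not_less)
  have eZ: "e \<notin> Z" using e by (auto simp: Z_def)
  \<comment> \<open>Since \<open>j\<close> lies outside \<open>Z\<close>, the exchange cannot shrink
    the intersection with \<open>Z\<close>, so maximality is inherited.\<close>
  have in_M: "insert i (B - {j}) \<in> M"
    if "B \<in> M" "i \<in> E" "i \<notin> B" "j \<in> B" "j \<notin> Z" "\<mu> (insert i (B - {j})) \<noteq> \<infinity>" for B i j
  proof -
    have "insert i (B - {j}) \<in> bases E r \<mu>"
      using that Mb[OF that(1)] card_exchange[of B j i] by (auto simp: bases_def)
    moreover have "card (B \<inter> Z) \<le> card (insert i (B - {j}) \<inter> Z)"
      using that Mb[OF that(1)] by (intro card_mono) auto
    ultimately show ?thesis using that(1) unfolding M_def max_bases_def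
      by (auto intro: order_trans)
  qed
  have f_exchange: "f (insert i (B - {j})) =
      real_of_ereal (\<mu> (insert i (B - {j}))) - (\<Sum>i\<in>B - Z. v i) + v j - v i"
    if "B \<in> M" "i \<notin> B" "j \<in> B" "j \<notin> Z" "i \<notin> Z" for B i j
  proof -
    have "insert i (B - {j}) - Z = insert i ((B - Z) - {j})" using that by auto
    moreover have "(\<Sum>i\<in>insert i ((B - Z) - {j}). v i) = v i + (\<Sum>i\<in>(B - Z) - {j}. v i)"
      using that Mb[OF that(1)] by (intro sum.insert) auto
    moreover have "(\<Sum>i\<in>B - Z. v i) = v j + (\<Sum>i\<in>(B - Z) - {j}. v i)"
      using that Mb[OF that(1)] by (intro sum.remove) auto
    ultimately show ?thesis unfolding f_def by simp
  qed
  \<comment> \<open>If \<open>e\<close> is missing from the minimiser \<open>B0\<close>, the circuit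
    condition for \<open>insert e B0\<close> at \<open>e\<close> names a \<open>j\<close> with
    finite weight. Exchanging \<open>j\<close> for \<open>e\<close> stays in \<open>M\<close> and
    does not raise \<open>f\<close>, so the new basis is again a minimiser.\<close>
  obtain B where B: "B \<in> M" "e \<in> B" "\<And>B'. B' \<in> M \<Longrightarrow> f B \<le> f B'"
  proof (cases "e \<in> B0")
    case True
    then show ?thesis using B0 that by blast
  next
    case False
    have Te: "insert e B0 - {e} = B0" using False by auto
    obtain b where b: "\<mu> B0 = ereal b" using bases_value_real[OF vm Mb(1)[OF B0(1)]] .
    have "\<exists>j\<in>insert e B0 - {e}. \<mu> (insert e B0 - {j}) + w j \<le> \<mu> (insert e B0 - {e}) + w e"
      using L[unfolded satisfies_circuits_def, rule_format, of "insert e B0" e]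
        Mb[OF B0(1)] e False b Te by auto
    then obtain j where j: "j \<in> B0" and le: "\<mu> (insert e B0 - {j}) + w j \<le> \<mu> B0 + w e"
      unfolding Te by blast
    have eq: "insert e B0 - {j} = insert e (B0 - {j})" using j False by auto
    have jE: "j \<in> E" using j Mb[OF B0(1)] by auto
    have nm: "\<mu> (insert e (B0 - {j})) \<noteq> -\<infinity>"
      by (rule valuated_matroid_not_MInfty[OF vm])
        (use Mb[OF B0(1)] e False j card_exchange[of B0 j e] in auto)
    have fin: "\<mu> (insert e (B0 - {j})) \<noteq> \<infinity>" "w j \<noteq> \<infinity>"
      using le nm w[OF jE] e b unfolding eq by auto
    have jZ: "j \<notin> Z" using fin by (auto simp: Z_def)
    have m: "insert e (B0 - {j}) \<in> M" by (rule in_M[OF B0(1) e(1) False j jZ fin(1)])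
    obtain b' where b': "\<mu> (insert e (B0 - {j})) = ereal b'"
      using nm fin by (cases "\<mu> (insert e (B0 - {j}))") auto
    have "b' + v j \<le> b + v e" using le unfolding eq b b' wv[OF jE jZ] wv[OF e(1) eZ] by simp
    then have "f (insert e (B0 - {j})) \<le> f B0"
      unfolding f_exchange[OF B0(1) False j jZ eZ] by (simp add: f_def b b')
    then show ?thesis using that[OF m] B0(2) by (meson insertI1 order_trans)
  qed
  obtain b where b: "\<mu> B = ereal b" using bases_value_real[OF vm Mb(1)[OF B(1)]] .
  \<comment> \<open>Only a finite right-hand side matters. Then the exchanged set is a basis,
    \<open>i \<in> Z\<close> would contradict maximality of the intersection with \<open>Z\<close>,
    and otherwise minimality of \<open>f\<close> is the claim.\<close>
  have "\<mu> B + w i \<le> \<mu> (insert i (B - {e})) + w e" if i: "i \<in> E - B" for i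
  proof (cases "\<mu> (insert i (B - {e})) = \<infinity>")
    case True
    then show ?thesis using w[OF e(1)] by (simp add: plus_ereal.simps)
  next
    case False
    have m: "insert i (B - {e}) \<in> M" using in_M[OF B(1) _ _ B(2) eZ False] i by blast
    obtain b' where b': "\<mu> (insert i (B - {e})) = ereal b'"
      using bases_value_real[OF vm Mb(1)[OF m]] .
    have iZ: "i \<notin> Z"
    proof
      assume "i \<in> Z"
      then have "insert i (B - {e}) \<inter> Z = insert i (B \<inter> Z)" using eZ by auto
      then have "card (insert i (B - {e}) \<inter> Z) = Suc (card (B \<inter> Z))"
        using i Mb(4)[OF B(1)] by simp
      moreover have "card (insert i (B - {e}) \<inter> Z) \<le> card (B \<inter> Z)"
        using B(1) Mb(1)[OF m] unfolding M_def max_bases_def by blast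
      ultimately show False by simp
    qed
    have "f B \<le> f (insert i (B - {e}))" by (rule B(3)[OF m])
    then have "b + v i \<le> b' + v e"
      using f_exchange[OF B(1) _ B(2) eZ iZ] i by (simp add: f_def b b')
    then show ?thesis using i e eZ iZ by (simp add: b b' wv)
  qed
  then show "\<exists>B\<in>bases E r \<mu>. e \<in> B \<and> (\<forall>i\<in>E - B. \<mu> B + w i \<le> \<mu> (insert i (B - {e})) + w e)"
    using B(1,2) Mb(1) by blast
qed

lemma tropical_vectors_not_MInfty: "w \<in> tropical_vectors E \<Longrightarrow> i \<in> E \<Longrightarrow> w i \<noteq> -\<infinity>"
  by (auto simp: PiE_def Pi_def)

section \<open>Valuated quotients: solution sets and ranks\<close>

text \<open>One direction passes from circuits of \<mu> to its cocircuits and on to circuits of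
  \<nu>. For the converse it suffices to test the inclusion on single cocircuits of \<mu>: the
  circuit condition of \<nu> at such a vector is the required exchange.\<close>

lemma valuated_quotient_iff_satisfies_circuits:
  assumes vm: "valuated_matroid E r \<mu>" and vn: "valuated_matroid E s \<nu>"
  shows "valuated_quotient E r \<mu> s \<nu> \<longleftrightarrow>
    (\<forall>w\<in>tropical_vectors E. satisfies_circuits E r \<mu> w \<longrightarrow> satisfies_circuits E s \<nu> w)"
proof (intro iffI ballI impI)
  fix w assume "valuated_quotient E r \<mu> s \<nu>" "w \<in> tropical_vectors E" "satisfies_circuits E r \<mu> w"
  then show "satisfies_circuits E s \<nu> w"
    using spanned_by_cocircuits_satisfies_circuits[OF vm vn]
      satisfies_circuits_spanned_by_cocircuits[OF vm] tropical_vectors_not_MInfty by metis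
next
  assume incl: "\<forall>w\<in>tropical_vectors E. satisfies_circuits E r \<mu> w \<longrightarrow> satisfies_circuits E s \<nu> w"
  show "valuated_quotient E r \<mu> s \<nu>"
    unfolding valuated_quotient_def
  proof (intro ballI)
    fix I J i assume I: "I \<in> bases E r \<mu>" and J: "J \<in> bases E s \<nu>" and i: "i \<in> I - J"
    have fE: "finite E" using valuated_matroid_finite[OF vm] .
    have IE: "I \<subseteq> E" "card I = r" "finite I" using I fE by (auto simp: bases_def intro: finite_subset)
    have JE: "J \<subseteq> E" "card J = s" "finite J" using J fE by (auto simp: bases_def intro: finite_subset)
    define K where "K = I - {i}"
    have iK: "insert i K = I" using i by (auto simp: K_def)
    have iE: "i \<in> E" "i \<notin> K" using i IE by (auto simp: K_def)
    have cK: "card (insert l K) = r" if "l \<notin> K" for l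
      using that IE iK card_exchange[of I i l] i by (cases "l = i") (auto simp: K_def)
    \<comment> \<open>The valuated cocircuit of \<mu> belonging to the basis \<open>I\<close> with
      \<open>i\<close> removed.\<close>
    define w where "w = (\<lambda>l\<in>E. if l \<in> K then \<infinity> else \<mu> (insert l K))"
    have wi: "w i = \<mu> I" using iE iK by (simp add: w_def)
    have KE: "K \<subseteq> E" using IE by (auto simp: K_def)
    have wnm: "w l \<noteq> -\<infinity>" if "l \<in> E" for l
      using that valuated_matroid_not_MInfty[OF vm, of "insert l K"] cK KE by (auto simp: w_def)
    have "w i \<noteq> (\<lambda>i\<in>E. \<infinity>) i" using wi iE I by (simp add: bases_def)
    then have "w \<noteq> (\<lambda>i\<in>E. \<infinity>)" by metis
    then have wV: "w \<in> tropical_vectors E" using wnm by (auto simp: w_def)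
    have "satisfies_circuits E r \<mu> w"
      unfolding satisfies_circuits_def
    proof (intro allI impI)
      fix T e assume T: "T \<subseteq> E" "card T = r + 1" "e \<in> T" and fin: "\<mu> (T - {e}) + w e \<noteq> \<infinity>"
      have fT: "finite T" using T fE finite_subset by blast
      have eK: "e \<notin> K" "w e = \<mu> (insert e K)" "\<mu> (insert e K) \<noteq> \<infinity>" "\<mu> (T - {e}) \<noteq> \<infinity>"
        using fin T by (auto simp: w_def split: if_splits)
      have b: "insert e K \<in> bases E r \<mu>" "T - {e} \<in> bases E r \<mu>"
        using eK T fT cK IE by (auto simp: bases_def K_def)
      \<comment> \<open>Removing \<open>e\<close> from \<open>insert e K\<close> leaves
        \<open>K\<close>, so the exchange axiom of \<mu> produces exactly the cocircuit entry
        \<open>w j\<close> and the circuit entry \<open>\<mu> (T - {j})\<close>.\<close>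
      have "e \<in> insert e K - (T - {e})" by auto
      then obtain j where j: "j \<in> (T - {e}) - insert e K"
        "\<mu> (insert j (insert e K - {e})) + \<mu> (insert e (T - {e} - {j})) \<le> \<mu> (insert e K) + \<mu> (T - {e})"
        using vm b unfolding valuated_matroid_def by blast
      have "insert e K - {e} = K" "insert e (T - {e} - {j}) = T - {j}" using eK j T by auto
      moreover have "w j = \<mu> (insert j K)" using j T by (auto simp: w_def)
      ultimately have "\<mu> (T - {j}) + w j \<le> \<mu> (T - {e}) + w e"
        using j(2) eK(2) by (simp add: add.commute)
      then show "\<exists>j\<in>T - {e}. \<mu> (T - {j}) + w j \<le> \<mu> (T - {e}) + w e" using j by blast
    qed
    with incl wV have L: "satisfies_circuits E s \<nu> w" by blast
    have iJ: "insert i J - {i} = J" using i by auto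
    \<comment> \<open>The circuit set \<open>insert i J\<close> is chosen so that the term at
      \<open>i\<close> equals \<open>\<nu> J + \<mu> I\<close>.\<close>
    have "\<exists>j\<in>insert i J - {i}. \<nu> (insert i J - {j}) + w j \<le> \<nu> (insert i J - {i}) + w i"
      using L[unfolded satisfies_circuits_def, rule_format, of "insert i J" i]
        JE i iE I J wi iJ by (auto simp: bases_def)
    then obtain j where j: "j \<in> J" and le: "\<nu> (insert i J - {j}) + w j \<le> \<nu> J + \<mu> I"
      unfolding iJ wi by blast
    have ij: "insert i J - {j} = insert i (J - {j})" using i j by auto
    have jE: "j \<in> E" using j JE by auto
    have "\<nu> (insert i (J - {j})) \<noteq> -\<infinity>"
      by (rule valuated_matroid_not_MInfty[OF vn])
        (use JE iE i j card_exchange[of J j i] in auto)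
    moreover have "\<nu> J + \<mu> I \<noteq> \<infinity>" using I J by (simp add: bases_def)
    \<comment> \<open>The entry infinity on \<open>K\<close> keeps \<open>j\<close> out of
      \<open>K\<close>; as \<open>i\<close> is not in \<open>J\<close>, also \<open>j\<close>
      differs from \<open>i\<close>, hence lies outside \<open>I\<close>.\<close>
    ultimately have "w j \<noteq> \<infinity>" using le unfolding ij by auto
    then have wj: "j \<notin> K" "w j = \<mu> (insert j K)" using jE by (auto simp: w_def split: if_splits)
    have "j \<in> J - I" using wj(1) j i by (auto simp: K_def)
    moreover have "\<mu> (insert j (I - {i})) + \<nu> (insert i (J - {j})) \<le> \<mu> I + \<nu> J"
      using le unfolding ij wj(2) K_def by (simp add: add.commute)
    ultimately show "\<exists>j\<in>J - I. \<mu> (insert j (I - {i})) + \<nu> (insert i (J - {j})) \<le> \<mu> I + \<nu> J"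
      by blast
  qed
qed

text \<open>Flags require nondecreasing ranks, which a chain of inclusions does not mention.
  Repeated quotient exchanges against a fixed basis \<open>J\<close> of \<nu> push a basis of \<mu>
  into \<open>J\<close>, so its size is at most that of \<open>J\<close>.\<close>

lemma valuated_quotient_rank_le:
  assumes vm: "valuated_matroid E r \<mu>" and vn: "valuated_matroid E s \<nu>"
    and q: "valuated_quotient E r \<mu> s \<nu>"
  shows "r \<le> s"
proof -
  have fE: "finite E" using valuated_matroid_finite[OF vm] .
  obtain J where J: "J \<in> bases E s \<nu>" using valuated_matroid_bases_nonempty[OF vn] by blast
  then have JE: "J \<subseteq> E" "card J = s" "finite J" using fE by (auto simp: bases_def intro: finite_subset)
  \<comment> \<open>A basis of \<open>\<mu>\<close> as close as possible to \<open>J\<close> is contained in \<open>J\<close>.\<close>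
  have *: "\<exists>I\<in>bases E r \<mu>. I \<subseteq> J" if "I \<in> bases E r \<mu>" for I
    using that
  proof (induction "card (I - J)" arbitrary: I)
    case 0
    have "finite (I - J)" using 0 fE by (auto simp: bases_def intro: finite_subset)
    then show ?case using 0 by auto
  next
    case (Suc n)
    have fI: "finite I" "I \<subseteq> E" "card I = r" using Suc fE by (auto simp: bases_def intro: finite_subset)
    obtain i where i: "i \<in> I - J" using Suc by (metis card.empty ex_in_conv nat.distinct(1))
    obtain j where j: "j \<in> J - I"
      and le: "\<mu> (insert j (I - {i})) + \<nu> (insert i (J - {j})) \<le> \<mu> I + \<nu> J"
      using q Suc.prems J i unfolding valuated_quotient_def by blast
    have "\<nu> (insert i (J - {j})) \<noteq> -\<infinity>"
      by (rule valuated_matroid_not_MInfty[OF vn])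
        (use JE fI i j card_exchange[of J j i] in auto)
    moreover have "\<mu> I + \<nu> J \<noteq> \<infinity>" using Suc.prems J by (simp add: bases_def)
    ultimately have "\<mu> (insert j (I - {i})) \<noteq> \<infinity>" using le by auto
    then have b: "insert j (I - {i}) \<in> bases E r \<mu>"
      using fI JE i j card_exchange[of I i j] by (auto simp: bases_def)
    have "insert j (I - {i}) - J = (I - J) - {i}" using j by auto
    then have "n = card (insert j (I - {i}) - J)" using Suc.hyps(2) i fI by simp
    then show ?case using Suc.hyps(1) b by blast
  qed
  obtain I where "I \<in> bases E r \<mu>" using valuated_matroid_bases_nonempty[OF vm] by blast
  with * obtain I where "I \<in> bases E r \<mu>" "I \<subseteq> J" by blast
  then show ?thesis using JE card_mono[of J I] by (auto simp: bases_def)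
qed

section \<open>Circuit conditions on the torus and in contractions\<close>

text \<open>Of two distinct minimisers at least one differs from \<open>e\<close>, and its term is
  at most the one at \<open>e\<close>. Conversely, the condition applied at one minimiser yields a
  second. For real \<open>u\<close>, the excluded all-infinite circuit vectors satisfy the condition
  vacuously.\<close>

lemma min_attained_twice_iff_satisfies_circuits:
  assumes vm: "valuated_matroid E r \<mu>"
  shows "(\<forall>C\<in>valuated_circuits E r \<mu>. min_attained_twice E C u) \<longleftrightarrow>
    satisfies_circuits E r \<mu> (\<lambda>i. ereal (u i))"
proof (intro iffI ballI)
  assume h: "\<forall>C\<in>valuated_circuits E r \<mu>. min_attained_twice E C u"
  show "satisfies_circuits E r \<mu> (\<lambda>i. ereal (u i))"
    unfolding satisfies_circuits_def
  proof (intro allI impI)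
    fix T e assume T: "T \<subseteq> E" "card T = r + 1" "e \<in> T" and fin: "\<mu> (T - {e}) + ereal (u e) \<noteq> \<infinity>"
    define C where "C = circuit_vector E \<mu> T"
    have Ck: "C k = (if k \<in> T then \<mu> (T - {k}) else \<infinity>)" if "k \<in> E" for k
      using that by (simp add: C_def circuit_vector_def)
    have Ce: "C e = \<mu> (T - {e})" "e \<in> E" using T Ck[of e] by auto
    then have "C e \<noteq> (\<lambda>i\<in>E. \<infinity>) e" using fin by auto
    then have "C \<noteq> (\<lambda>i\<in>E. \<infinity>)" by metis
    then have "C \<in> valuated_circuits E r \<mu>"
      using T unfolding valuated_circuits_def C_def by blast
    then obtain i j where ij: "i \<noteq> j"
      "is_arg_min (\<lambda>k. C k + ereal (u k)) (\<lambda>k. k \<in> E \<and> C k \<noteq> \<infinity>) i"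
      "is_arg_min (\<lambda>k. C k + ereal (u k)) (\<lambda>k. k \<in> E \<and> C k \<noteq> \<infinity>) j"
      using h unfolding min_attained_twice_def by blast
    obtain k where k: "k \<noteq> e" "is_arg_min (\<lambda>k. C k + ereal (u k)) (\<lambda>k. k \<in> E \<and> C k \<noteq> \<infinity>) k"
      using ij by metis
    have kE: "k \<in> E" "C k \<noteq> \<infinity>" and "C k + ereal (u k) \<le> C e + ereal (u e)"
      using k(2) Ce fin unfolding is_arg_min_linorder by auto
    moreover have "k \<in> T" using kE Ck[of k] by (auto split: if_splits)
    ultimately show "\<exists>j\<in>T - {e}. \<mu> (T - {j}) + ereal (u j) \<le> \<mu> (T - {e}) + ereal (u e)"
      using k(1) Ck Ce by auto
  qed
next
  fix C assume L: "satisfies_circuits E r \<mu> (\<lambda>i. ereal (u i))" and C: "C \<in> valuated_circuits E r \<mu>"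
  from C obtain T where T: "T \<subseteq> E" "card T = r + 1" and CT: "C = circuit_vector E \<mu> T"
    and ne: "C \<noteq> (\<lambda>i\<in>E. \<infinity>)"
    unfolding valuated_circuits_def by blast
  have Ck: "C k = (if k \<in> T then \<mu> (T - {k}) else \<infinity>)" if "k \<in> E" for k
    using that by (simp add: CT circuit_vector_def)
  have "\<exists>k\<in>E. C k \<noteq> \<infinity>"
  proof (rule ccontr)
    assume "\<not> (\<exists>k\<in>E. C k \<noteq> \<infinity>)"
    then have "C = (\<lambda>i\<in>E. \<infinity>)" by (auto simp: CT circuit_vector_def fun_eq_iff)
    with ne show False ..
  qed
  then have F: "finite {k \<in> E. C k \<noteq> \<infinity>}" "{k \<in> E. C k \<noteq> \<infinity>} \<noteq> {}"
    using valuated_matroid_finite[OF vm] by auto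
  let ?f = "\<lambda>k. C k + ereal (u k)"
  from ex_is_arg_min_if_finite[OF F, of ?f]
  obtain i where i: "is_arg_min ?f (\<lambda>k. k \<in> E \<and> C k \<noteq> \<infinity>) i" by auto
  then have iE: "i \<in> E" "C i \<noteq> \<infinity>" by (auto simp: is_arg_min_def)
  then have iT: "i \<in> T" "C i = \<mu> (T - {i})" using Ck[of i] by (auto split: if_splits)
  then obtain j where j: "j \<in> T - {i}" "\<mu> (T - {j}) + ereal (u j) \<le> \<mu> (T - {i}) + ereal (u i)"
    using L[unfolded satisfies_circuits_def, rule_format, of T i] T iE by auto
  have jE: "j \<in> E" "C j = \<mu> (T - {j})" using j T Ck[of j] by auto
  have le: "?f j \<le> ?f i" using j(2) iT jE by simp
  then have "C j \<noteq> \<infinity>" using iE by auto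
  then have "is_arg_min ?f (\<lambda>k. k \<in> E \<and> C k \<noteq> \<infinity>) j"
    using i jE le unfolding is_arg_min_linorder by (auto intro: order_trans)
  then show "min_attained_twice E C u" unfolding min_attained_twice_def using i j by blast
qed

text \<open>Makes the chosen contraction concrete: up to a real constant it is \<mu> with a fixed
  basis \<open>A\<close> of the restriction to \<open>S\<close> adjoined. The identity also covers
  infinite values, so circuit entries can be translated without case distinctions on bases.\<close>

lemma contraction_obtain:
  assumes vm: "valuated_matroid E r \<mu>" and S: "S \<subseteq> E"
  defines "q \<equiv> matroid_rank E r \<mu> S" and "\<kappa> \<equiv> contraction E r \<mu> S"
  obtains A a where "A \<subseteq> S" "card A = q" "q \<le> r" "valuated_matroid (E - S) (r - q) \<kappa>"
    "\<And>J. J \<subseteq> E - S \<Longrightarrow> card J = r - q \<Longrightarrow> \<mu> (A \<union> J) = \<kappa> J + ereal a"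
    "\<And>B. B \<in> bases E r \<mu> \<Longrightarrow> card (B \<inter> S) \<le> q"
proof -
  have fE: "finite E" using valuated_matroid_finite[OF vm] .
  have "\<exists>\<rho>. is_restriction_contraction E r \<mu> S \<rho> \<kappa>"
    unfolding \<kappa>_def contraction_def
    by (rule someI_ex[where P = "\<lambda>\<kappa>. \<exists>\<rho>. is_restriction_contraction E r \<mu> S \<rho> \<kappa>"])
      (use contraction_exists[OF vm S] in blast)
  then obtain \<rho> where rc: "is_restriction_contraction E r \<mu> S \<rho> \<kappa>" by blast
  from rc have v\<kappa>: "valuated_matroid (E - S) (r - q) \<kappa>"
    and b\<kappa>: "bases (E - S) (r - q) \<kappa> = (\<lambda>B. B - S) ` max_bases E r \<mu> S"
    and sum: "\<And>B. B \<in> max_bases E r \<mu> S \<Longrightarrow> \<mu> B = \<rho> (B \<inter> S) + \<kappa> (B - S)"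
    unfolding is_restriction_contraction_def Let_def q_def by simp_all
  obtain B0 where B0: "B0 \<in> max_bases E r \<mu> S" using max_bases_nonempty[OF vm] by blast
  define A where "A = B0 \<inter> S"
  have B0E: "B0 \<subseteq> E" "card B0 = r" "B0 \<in> bases E r \<mu>"
    using B0 by (auto simp: max_bases_def bases_def)
  have fB0: "finite B0" using B0E fE finite_subset by blast
  have q: "q = card A" using matroid_rank_eq[OF vm B0] by (simp add: q_def A_def)
  have qr: "q \<le> r" unfolding q A_def B0E(2)[symmetric] using fB0 by (intro card_mono) auto
  have le: "card (B \<inter> S) \<le> q" if "B \<in> bases E r \<mu>" for B
    using B0 that unfolding q A_def max_bases_def by blast
  have "\<mu> B0 = \<rho> A + \<kappa> (B0 - S)" using sum[OF B0] by (simp add: A_def)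
  then obtain a where a: "\<rho> A = ereal a"
    using max_bases_finite_value[OF vm B0] by (cases "\<rho> A"; cases "\<kappa> (B0 - S)") auto
  have "\<mu> (A \<union> J) = \<kappa> J + ereal a" if J: "J \<subseteq> E - S" "card J = r - q" for J
  proof -
    have s: "(A \<union> J) \<inter> S = A" "(A \<union> J) - S = J" using J by (auto simp: A_def)
    have "card (A \<union> J) = card A + card J"
      using J fE fB0 by (intro card_Un_disjoint) (auto simp: A_def intro: finite_subset)
    then have c: "card (A \<union> J) = r" "A \<union> J \<subseteq> E" using J q qr B0E by (auto simp: A_def)
    show ?thesis
    proof (cases "A \<union> J \<in> max_bases E r \<mu> S")
      case True
      then show ?thesis using sum[OF True] s a by (simp add: add.commute)
    next
      case False
      \<comment> \<open>Both sides are infinite here: \<open>A \<union> J\<close> meets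
        \<open>S\<close> in \<open>q\<close> elements, so being a basis would make it maximal; and
        if \<open>J\<close> were a basis of the contraction, the product property of maximal bases
        would make \<open>A \<union> J\<close> maximal.\<close>
      have "A \<union> J \<notin> bases E r \<mu>"
        using False le s(1) q by (auto simp: max_bases_def)
      then have i1: "\<mu> (A \<union> J) = \<infinity>" using c by (auto simp: bases_def)
      have "J \<notin> bases (E - S) (r - q) \<kappa>"
      proof
        assume "J \<in> bases (E - S) (r - q) \<kappa>"
        then obtain B where B: "B \<in> max_bases E r \<mu> S" "J = B - S" using b\<kappa> by auto
        show False using max_bases_product[OF vm S B(1) B0] B(2) False by (simp add: A_def)
      qed
      then show ?thesis using J i1 by (auto simp: bases_def)
    qed
  qed
  then show ?thesis using that[of A a] q qr v\<kappa> le by (auto simp: A_def)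
qed

text \<open>A circuit set in \<open>E\<close> may meet \<open>S\<close> arbitrarily, so lifting from
  the contraction goes through cocircuits, where adjoining \<open>A\<close> to the basis suffices.
  Descending is direct, by adjoining \<open>A\<close> to the circuit set.\<close>

lemma satisfies_circuits_contraction:
  assumes vm: "valuated_matroid E r \<mu>" and S: "S \<subseteq> E"
  shows "satisfies_circuits (E - S) (r - matroid_rank E r \<mu> S) (contraction E r \<mu> S) (\<lambda>i. ereal (u i))
    \<longleftrightarrow> satisfies_circuits E r \<mu> (\<lambda>i\<in>E. if i \<in> S then \<infinity> else ereal (u i))"
proof -
  define q \<kappa> where "q = matroid_rank E r \<mu> S" and "\<kappa> = contraction E r \<mu> S"
  define w where "w = (\<lambda>i\<in>E. if i \<in> S then \<infinity> else ereal (u i))"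
  have fE: "finite E" using valuated_matroid_finite[OF vm] .
  obtain A a where A: "A \<subseteq> S" "card A = q" and qr: "q \<le> r"
    and v\<kappa>: "valuated_matroid (E - S) (r - q) \<kappa>"
    and \<mu>A: "\<And>J. J \<subseteq> E - S \<Longrightarrow> card J = r - q \<Longrightarrow> \<mu> (A \<union> J) = \<kappa> J + ereal a"
    and le: "\<And>B. B \<in> bases E r \<mu> \<Longrightarrow> card (B \<inter> S) \<le> q"
    using contraction_obtain[OF vm S] unfolding q_def \<kappa>_def by metis
  have fA: "finite A" using A S fE by (meson finite_subset)
  have cA: "card (A \<union> J) = q + card J" if "J \<subseteq> E - S" for J
    unfolding A(2)[symmetric] using that fA fE A by (intro card_Un_disjoint) (auto intro: finite_subset)
  have wnm: "w i \<noteq> -\<infinity>" if "i \<in> E" for i using that by (auto simp: w_def)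
  have wS: "w i = \<infinity>" if "i \<in> S" for i using that S by (auto simp: w_def)
  have wE: "w i = ereal (u i)" if "i \<in> E - S" for i using that by (auto simp: w_def)
  have "satisfies_circuits E r \<mu> w" if L: "satisfies_circuits (E - S) (r - q) \<kappa> (\<lambda>i. ereal (u i))"
  proof -
    have sp: "spanned_by_cocircuits (E - S) (r - q) \<kappa> (\<lambda>i. ereal (u i))"
      by (rule satisfies_circuits_spanned_by_cocircuits[OF v\<kappa> _ L]) simp
    have "spanned_by_cocircuits E r \<mu> w"
      unfolding spanned_by_cocircuits_def
    proof (intro ballI impI)
      fix e assume e: "e \<in> E" "w e \<noteq> \<infinity>"
      then have eS: "e \<in> E - S" using wS by blast
      then obtain B where B: "B \<in> bases (E - S) (r - q) \<kappa>" "e \<in> B"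
        and B_le: "\<And>i. i \<in> (E - S) - B \<Longrightarrow> \<kappa> B + ereal (u i) \<le> \<kappa> (insert i (B - {e})) + ereal (u e)"
        using sp unfolding spanned_by_cocircuits_def by force
      have BE: "B \<subseteq> E - S" "card B = r - q" "\<kappa> B \<noteq> \<infinity>" using B by (auto simp: bases_def)
      have fB: "finite B" using BE fE by (meson finite_Diff finite_subset)
      have bAB: "A \<union> B \<in> bases E r \<mu>"
        using \<mu>A[OF BE(1,2)] cA[OF BE(1)] BE qr A S by (auto simp: bases_def)
      have eA: "e \<notin> A" using eS A by blast
      have "\<mu> (A \<union> B) + w i \<le> \<mu> (insert i (A \<union> B - {e})) + w e" if i: "i \<in> E - (A \<union> B)" for i
      proof (cases "i \<in> S")
        case True
        \<comment> \<open>The exchanged set would meet \<open>S\<close> in q + 1 elements, more than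
          any basis does, so its value is infinite and domination is trivial.\<close>
        have "insert i (A \<union> B - {e}) \<inter> S = insert i A" using True A BE eA by auto
        then have "card (insert i (A \<union> B - {e}) \<inter> S) = Suc q" using i A fA by simp
        then have "insert i (A \<union> B - {e}) \<notin> bases E r \<mu>" using le by fastforce
        moreover have "card (insert i (A \<union> B - {e})) = r"
          using card_exchange[of "A \<union> B" e i] fA fB B i bAB by (auto simp: bases_def)
        ultimately have "\<mu> (insert i (A \<union> B - {e})) = \<infinity>"
          using i A S BE by (auto simp: bases_def)
        then show ?thesis using wE[OF eS] by simp
      next
        case False
        have iB: "i \<in> (E - S) - B" using i False by blast
        have "insert i (A \<union> B - {e}) = A \<union> insert i (B - {e})" using eA by auto
        moreover have "\<mu> (A \<union> insert i (B - {e})) = \<kappa> (insert i (B - {e})) + ereal a"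
          by (rule \<mu>A) (use iB BE card_exchange[OF fB B(2)] in auto)
        moreover have "w i = ereal (u i)" using wE iB by blast
        ultimately show ?thesis
          using B_le[OF iB] \<mu>A[OF BE(1,2)] wE[OF eS]
          by (cases "\<kappa> B"; cases "\<kappa> (insert i (B - {e}))") auto
      qed
      then show "\<exists>B\<in>bases E r \<mu>. e \<in> B \<and> (\<forall>i\<in>E - B. \<mu> B + w i \<le> \<mu> (insert i (B - {e})) + w e)"
        using bAB B(2) by blast
    qed
    \<comment> \<open>By the exchange axiom \<mu> is a quotient of itself, which turns the cocircuit
      span back into circuit conditions.\<close>
    then show ?thesis
      using spanned_by_cocircuits_satisfies_circuits[OF vm vm valuated_matroid_self_quotient[OF vm]]
        wnm by blast
  qed
  moreover have "satisfies_circuits (E - S) (r - q) \<kappa> (\<lambda>i. ereal (u i))"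
    if L: "satisfies_circuits E r \<mu> w"
    unfolding satisfies_circuits_def
  proof (intro allI impI)
    fix T e assume T: "T \<subseteq> E - S" "card T = r - q + 1" "e \<in> T"
      and fin: "\<kappa> (T - {e}) + ereal (u e) \<noteq> \<infinity>"
    have fT: "finite T" using T fE by (meson finite_Diff finite_subset)
    have diff: "\<mu> (A \<union> T - {j}) = \<kappa> (T - {j}) + ereal a" if "j \<in> T" for j
    proof -
      have "A \<union> T - {j} = A \<union> (T - {j})" using that T A by auto
      moreover have "\<mu> (A \<union> (T - {j})) = \<kappa> (T - {j}) + ereal a"
        by (rule \<mu>A) (use T fT that in auto)
      ultimately show ?thesis by simp
    qed
    have we: "w e = ereal (u e)" using wE T by blast
    have fin': "\<mu> (A \<union> T - {e}) + w e \<noteq> \<infinity>" using diff[OF T(3)] fin we by simp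
    \<comment> \<open>Because \<open>q \<le> r\<close>, the truncated subtraction is exact and
      \<open>A \<union> T\<close> has r + 1 elements. The witness has a finite weight, while
      \<open>w\<close> is infinite on \<open>A\<close>, so it falls into \<open>T\<close>.\<close>
    obtain j where j: "j \<in> A \<union> T - {e}" "\<mu> (A \<union> T - {j}) + w j \<le> \<mu> (A \<union> T - {e}) + w e"
      using L[unfolded satisfies_circuits_def, rule_format, of "A \<union> T" e]
        T cA[OF T(1)] qr A S fin' by auto
    have "\<mu> (A \<union> T - {j}) \<noteq> -\<infinity>"
      by (rule valuated_matroid_not_MInfty[OF vm]) (use T cA[OF T(1)] qr A S fA fT j in auto)
    then have "w j \<noteq> \<infinity>" using j(2) fin' by auto
    then have jT: "j \<in> T - {e}" using j A wS by blast
    then have wj: "w j = ereal (u j)" using wE T by blast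
    have "\<kappa> (T - {j}) + ereal (u j) \<le> \<kappa> (T - {e}) + ereal (u e)"
      using j(2) diff[of j] diff[of e] jT T we wj
      by (cases "\<kappa> (T - {j})"; cases "\<kappa> (T - {e})") auto
    then show "\<exists>j\<in>T - {e}. \<kappa> (T - {j}) + ereal (u j) \<le> \<kappa> (T - {e}) + ereal (u e)" using jT by blast
  qed
  ultimately show ?thesis unfolding q_def \<kappa>_def w_def by blast
qed

section \<open>From solution vectors to projective classes\<close>

lemma satisfies_circuits_shift:
  assumes L: "satisfies_circuits E r \<mu> w"
  shows "satisfies_circuits E r \<mu> (\<lambda>i\<in>E. w i + ereal c)"
  unfolding satisfies_circuits_def
proof (intro allI impI)
  fix T e assume T: "T \<subseteq> E" "card T = r + 1" "e \<in> T"
    and fin: "\<mu> (T - {e}) + (\<lambda>i\<in>E. w i + ereal c) e \<noteq> \<infinity>"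
  have r: "\<mu> (T - {j}) + (\<lambda>i\<in>E. w i + ereal c) j = \<mu> (T - {j}) + w j + ereal c" if "j \<in> T" for j
    using that T by (auto simp: add.assoc)
  have "\<mu> (T - {e}) + w e \<noteq> \<infinity>" using fin r[OF T(3)] by auto
  then obtain j where j: "j \<in> T - {e}" "\<mu> (T - {j}) + w j \<le> \<mu> (T - {e}) + w e"
    using L T unfolding satisfies_circuits_def by blast
  have "\<mu> (T - {j}) + (\<lambda>i\<in>E. w i + ereal c) j \<le> \<mu> (T - {e}) + (\<lambda>i\<in>E. w i + ereal c) e"
    using r[of j] r[of e] add_right_mono[OF j(2)] j(1) T(3) by (simp only: Diff_iff)
  with j(1) show "\<exists>j\<in>T - {e}. \<mu> (T - {j}) + (\<lambda>i\<in>E. w i + ereal c) j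
      \<le> \<mu> (T - {e}) + (\<lambda>i\<in>E. w i + ereal c) e" ..
qed

lemma stratum_embedding_class:
  "stratum_embedding E S (range (\<lambda>c. \<lambda>i\<in>E - S. u i + c)) =
    projective_class E (\<lambda>i\<in>E. if i \<in> S then \<infinity> else ereal (u i))"
proof -
  have "(\<lambda>i\<in>E. if i \<in> S then \<infinity> else ereal ((\<lambda>i\<in>E - S. u i + c) i)) =
      (\<lambda>i\<in>E. (\<lambda>i\<in>E. if i \<in> S then \<infinity> else ereal (u i)) i + ereal c)" for c
    by (auto simp: fun_eq_iff)
  then show ?thesis unfolding stratum_embedding_def image_image by simp
qed

lemma real_torus_iff:
  "U \<in> real_torus E \<longleftrightarrow> (\<exists>u\<in>E \<rightarrow>\<^sub>E UNIV. U = range (\<lambda>c. \<lambda>i\<in>E. u i + c))"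
proof -
  have "{(u, v). u \<in> E \<rightarrow>\<^sub>E UNIV \<and> (\<exists>c. v = (\<lambda>i\<in>E. u i + c))} `` {u} =
      range (\<lambda>c. \<lambda>i\<in>E. u i + c)" if "u \<in> E \<rightarrow>\<^sub>E UNIV" for u :: "'a \<Rightarrow> real"
    using that by auto
  then show ?thesis unfolding real_torus_def quotient_def by auto
qed

text \<open>Gluing the strata: a solution vector lies in the stratum indexed by its set
  \<open>S\<close> of infinite coordinates, where its conditions are those of the contraction by
  \<open>S\<close>. Properness of \<open>S\<close> corresponds to excluding the all-infinite
  vector.\<close>

lemma projective_trop_eq:
  assumes vm: "valuated_matroid E r \<mu>"
  shows "projective_trop E r \<mu> =
    projective_class E ` {w \<in> tropical_vectors E. satisfies_circuits E r \<mu> w}"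
proof (intro set_eqI iffI)
  fix X assume "X \<in> projective_trop E r \<mu>"
  then obtain S U where S: "S \<subset> E" and X: "X = stratum_embedding E S U"
    and U: "U \<in> trop (E - S) (r - matroid_rank E r \<mu> S) (contraction E r \<mu> S)"
    unfolding projective_trop_def by blast
  from U obtain u where u: "U = range (\<lambda>c. \<lambda>i\<in>E - S. u i + c)"
    and uE: "u \<in> (E - S) \<rightarrow>\<^sub>E UNIV"
    unfolding trop_def real_torus_iff by blast
  define w where "w = (\<lambda>i\<in>E. if i \<in> S then \<infinity> else ereal (u i))"
  have SE: "S \<subseteq> E" using S by blast
  have "u = (\<lambda>i\<in>E - S. u i + 0)" using uE by (simp add: PiE_restrict)
  then have "u \<in> U" unfolding u by blast
  moreover have "valuated_matroid (E - S) (r - matroid_rank E r \<mu> S) (contraction E r \<mu> S)"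
    using contraction_obtain[OF vm SE] by metis
  ultimately have "satisfies_circuits E r \<mu> w"
    using U min_attained_twice_iff_satisfies_circuits satisfies_circuits_contraction[OF vm SE]
    unfolding trop_def w_def by blast
  moreover obtain e where e: "e \<in> E" "e \<notin> S" using S by blast
  have "w e \<noteq> (\<lambda>i\<in>E. \<infinity>) e" using e by (simp add: w_def)
  then have "w \<noteq> (\<lambda>i\<in>E. \<infinity>)" by metis
  then have "w \<in> tropical_vectors E" by (auto simp: w_def)
  moreover have "X = projective_class E w" unfolding X u stratum_embedding_class w_def ..
  ultimately show "X \<in> projective_class E ` {w \<in> tropical_vectors E. satisfies_circuits E r \<mu> w}"
    by blast
next
  fix X assume "X \<in> projective_class E ` {w \<in> tropical_vectors E. satisfies_circuits E r \<mu> w}"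
  then obtain w where w: "w \<in> tropical_vectors E" "satisfies_circuits E r \<mu> w"
    and X: "X = projective_class E w" by blast
  define S where "S = {i \<in> E. w i = \<infinity>}"
  define u where "u = (\<lambda>i\<in>E - S. real_of_ereal (w i))"
  define U where "U = range (\<lambda>c. \<lambda>i\<in>E - S. u i + c)"
  have "w \<noteq> (\<lambda>i\<in>E. \<infinity>)" "w \<in> extensional E" using w by (auto simp: PiE_def)
  then have "\<not> (\<forall>i\<in>E. w i = \<infinity>)" by (metis extensional_restrict restrict_ext)
  then have "S \<noteq> E" by (auto simp: S_def)
  then have S: "S \<subset> E" "S \<subseteq> E" by (auto simp: S_def)
  have wu: "w = (\<lambda>i\<in>E. if i \<in> S then \<infinity> else ereal (u i))"
  proof
    fix i show "w i = (\<lambda>i\<in>E. if i \<in> S then \<infinity> else ereal (u i)) i"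
      using \<open>w \<in> extensional E\<close> tropical_vectors_not_MInfty[OF w(1), of i]
      by (cases "w i") (auto simp: S_def u_def extensional_def)
  qed
  have v: "valuated_matroid (E - S) (r - matroid_rank E r \<mu> S) (contraction E r \<mu> S)"
    using contraction_obtain[OF vm S(2)] by metis
  \<comment> \<open>Membership in \<open>trop\<close> quantifies over all representatives, so each
    shift of \<open>u\<close> is handled as a shift of \<open>w\<close>.\<close>
  have "\<forall>C\<in>valuated_circuits (E - S) (r - matroid_rank E r \<mu> S) (contraction E r \<mu> S).
      min_attained_twice (E - S) C u'" if u': "u' \<in> U" for u'
  proof -
    obtain c where c: "u' = (\<lambda>i\<in>E - S. u i + c)" using u' unfolding U_def by blast
    have "(\<lambda>i\<in>E. if i \<in> S then \<infinity> else ereal (u' i)) = (\<lambda>i\<in>E. w i + ereal c)"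
      unfolding wu c by (auto simp: fun_eq_iff)
    then show ?thesis
      using satisfies_circuits_shift[OF w(2), of c]
      unfolding min_attained_twice_iff_satisfies_circuits[OF v]
        satisfies_circuits_contraction[OF vm S(2)] by simp
  qed
  moreover have "U \<in> real_torus (E - S)"
    unfolding real_torus_iff U_def by (rule bexI[of _ u]) (auto simp: u_def)
  ultimately have "U \<in> trop (E - S) (r - matroid_rank E r \<mu> S) (contraction E r \<mu> S)"
    unfolding trop_def by blast
  moreover have "X = stratum_embedding E S U"
    unfolding X U_def stratum_embedding_class wu[symmetric] ..
  ultimately show "X \<in> projective_trop E r \<mu>" unfolding projective_trop_def using S by blast
qed

section \<open>Inclusions of projective tropical linear spaces and flags\<close>

lemma projective_trop_subset_iff:
  assumes vm: "valuated_matroid E r \<mu>" and vn: "valuated_matroid E s \<nu>"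
  shows "projective_trop E r \<mu> \<subseteq> projective_trop E s \<nu> \<longleftrightarrow>
    (\<forall>w\<in>tropical_vectors E. satisfies_circuits E r \<mu> w \<longrightarrow> satisfies_circuits E s \<nu> w)"
proof (intro iffI ballI impI)
  fix w assume sub: "projective_trop E r \<mu> \<subseteq> projective_trop E s \<nu>"
    and w: "w \<in> tropical_vectors E" "satisfies_circuits E r \<mu> w"
  have "projective_class E w \<in> projective_trop E s \<nu>"
    using sub w unfolding projective_trop_eq[OF vm] by blast
  then obtain w' where w': "satisfies_circuits E s \<nu> w'" "projective_class E w = projective_class E w'"
    unfolding projective_trop_eq[OF vn] by blast
  \<comment> \<open>Equality of classes makes \<open>w\<close> only a shift of the solution
    \<open>w'\<close>, and solutions are closed under shifts.\<close>
  have "w = (\<lambda>i\<in>E. w i + ereal 0)" using w by (auto simp: PiE_def extensional_def fun_eq_iff)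
  then have "w \<in> projective_class E w" by blast
  then obtain c where "w = (\<lambda>i\<in>E. w' i + ereal c)" unfolding w'(2) by blast
  then show "satisfies_circuits E s \<nu> w" using satisfies_circuits_shift[OF w'(1)] by simp
qed (unfold projective_trop_eq[OF vm] projective_trop_eq[OF vn], blast)

lemma valuated_quotient_iff_projective_trop_subset:
  assumes "valuated_matroid E r \<mu>" "valuated_matroid E s \<nu>"
  shows "valuated_quotient E r \<mu> s \<nu> \<longleftrightarrow> projective_trop E r \<mu> \<subseteq> projective_trop E s \<nu>"
  using valuated_quotient_iff_satisfies_circuits[OF assms] projective_trop_subset_iff[OF assms]
  by simp

text \<open>Inclusion is transitive, so consecutive inclusions give all pairs \<open>i < j\<close>;
  each inclusion is a quotient, and the quotient supplies the order of the ranks.\<close>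

lemma valuated_flag_matroid_iff_projective_trop_chain:
  assumes vm: "\<And>i. i \<in> {1..k} \<Longrightarrow> valuated_matroid E (r i) (\<mu> i)"
  shows "valuated_flag_matroid E k r \<mu> \<longleftrightarrow>
    (\<forall>i\<in>{1..<k}. projective_trop E (r i) (\<mu> i) \<subseteq> projective_trop E (r (Suc i)) (\<mu> (Suc i)))"
proof (intro iffI ballI)
  fix i assume "valuated_flag_matroid E k r \<mu>" "i \<in> {1..<k}"
  then have "valuated_quotient E (r i) (\<mu> i) (r (Suc i)) (\<mu> (Suc i))" "i \<in> {1..k}" "Suc i \<in> {1..k}"
    unfolding valuated_flag_matroid_def by auto
  then show "projective_trop E (r i) (\<mu> i) \<subseteq> projective_trop E (r (Suc i)) (\<mu> (Suc i))"
    using valuated_quotient_iff_projective_trop_subset[OF vm vm] by blast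
next
  assume chain: "\<forall>i\<in>{1..<k}. projective_trop E (r i) (\<mu> i) \<subseteq> projective_trop E (r (Suc i)) (\<mu> (Suc i))"
  have "r i \<le> r j \<and> valuated_quotient E (r i) (\<mu> i) (r j) (\<mu> j)"
    if ij: "i \<in> {1..k}" "j \<in> {1..k}" "i < j" for i j
  proof -
    have "i \<le> j" "j \<le> k" using ij by auto
    then have "projective_trop E (r i) (\<mu> i) \<subseteq> projective_trop E (r j) (\<mu> j)"
    proof (induction j rule: dec_induct)
      case (step m)
      then have "m \<in> {1..<k}" using ij(1) by auto
      with step chain show ?case by fastforce
    qed simp
    then have "valuated_quotient E (r i) (\<mu> i) (r j) (\<mu> j)"
      using valuated_quotient_iff_projective_trop_subset[OF vm vm] ij by blast
    then show ?thesis using valuated_quotient_rank_le[OF vm vm] ij by blast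
  qed
  then show "valuated_flag_matroid E k r \<mu>" unfolding valuated_flag_matroid_def using vm by blast
qed

theorem theorem4p15:
  fixes n :: nat
  shows "(\<forall>r s \<mu> \<nu>.
            valuated_matroid {1..n} r \<mu> \<longrightarrow> valuated_matroid {1..n} s \<nu> \<longrightarrow> r \<le> s \<longrightarrow>
            (valuated_quotient {1..n} r \<mu> s \<nu> \<longleftrightarrow>
               projective_trop {1..n} r \<mu> \<subseteq> projective_trop {1..n} s \<nu>)) \<and>
         (\<forall>k r \<mu>.
            (\<forall>i\<in>{1..k}. valuated_matroid {1..n} (r i) (\<mu> i)) \<longrightarrow>
            (valuated_flag_matroid {1..n} k r \<mu> \<longleftrightarrow>
               (\<forall>i\<in>{1..<k}. projective_trop {1..n} (r i) (\<mu> i)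
                             \<subseteq> projective_trop {1..n} (r (Suc i)) (\<mu> (Suc i)))))"
  using valuated_quotient_iff_projective_trop_subset valuated_flag_matroid_iff_projective_trop_chain
  by blast

end
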